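(* Let $\mathbf{g}=\{g_1,\dots,g_m\}$, $\mathbf{h}=\{h_1,\dots,h_s\}\subset\mathbb{Q}[\mathbf{x}]=\mathbb{Q}[x_1,\dots,x_n]$, where $\mathbf{h}$ is a graded basis of the zero-dimensional ideal $I=(\mathbf{h})\subset\mathbb{Q}[\mathbf{x}]$, let $B$ be a monomial basis of $\mathbb{Q}[\mathbf{x}]/I$, and let $$S=\{\xi\in\mathbb{R}^n : g_i(\xi)\ge 0 \text{ for } 1\le i\le m \text{ and } h_j(\xi)=0 \text{ for } 1\le j\le s\}.$$ Let $f\in\mathbb{Q}[\mathbf{x}]$ and let $f^*$ be the minimum of $f$ on $S$ (assumed nonempty). If $(I:f-f^* )+(f-f^* )=(1)$ (as ideals of $\mathbb{R}[\mathbf{x}]$, with $I$ extended to $\mathbb{R}[\mathbf{x}]$), then $f_{(\ell)}=f^*$ for every integer $$\ell\ge\tfrac12\max\{\deg(f),\ 2\deg(B)+\deg(g_i) : 0\le i\le m\},\qquad\text{where } g_0:=1.$$ Furthermore, for such $\ell$, $f-f^*$ has a certificate of nonnegativity $$f-f^*=\sum_k\omega_{0,k}q_{0,k}^2+\sum_{i=1}^m\Big(\sum_k\omega_{i,k}q_{i,k}^2\Big)g_i+\sum_{j=1}^sp_jh_j$$ with nonnegative weights $\omega_{i,k}$, in which all the terms $q_{0,k}^2$, $q_{i,k}^2g_i$, $p_jh_j$ have degree $\le2\ell$, and in which the weights are in $\mathbb{Q}$ and the polynomials $q_{i,k},p_j$ are in $\mathbb{Q}[\mathbf{x}]$ wh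en $f^*\in\mathbb{Q}$.
   Context: An ideal is zero-dimensional if it has finitely many complex zeros. $B$ is a set of monomials whose classes form a basis of $\mathbb{Q}[\mathbf{x}]/I$ and $\deg(B)$ is the maximum degree of its elements. $\mathbf{h}$ is a graded basis of $I$ if every $p\in I$ can be written $p=\sum_jp_jh_j$ with $\deg(p_j)\le\deg(p)-\deg(h_j)$ for all $j$. $(I:g)=\{h: gh\in I\}$. For $k\in\mathbb{N}$, let $\Sigma^2_{\mathbb{R},k}$ be the set of sums of squares of polynomials of $\mathbb{R}[\mathbf{x}]$ of degree $\le\lfloor k/2\rfloor$. The truncated quadratic module in degree $\le d$ is $$Q_{\mathbb{R},d}=\Sigma^2_{\mathbb{R},d}+\sum_{i=1}^m\Sigma^2_{\mathbb{R},d-\deg(g_i)}\,g_i+\sum_{j=1}^s\mathbb{R}[\mathbf{x}]_{d-\deg(h_j)}\,h_j,$$ where $\mathbb{R}[\mathbf{x}]_{k}$ is the set of polynomials of degree $\le k$. The order-$\ell$ SoS lower bound is $f_{(\ell)}:=\sup\{m'\in\mathbb{R}: f-m'\in Q_{\mathbb{R},2\ell}\}\le f^*$. *)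

theory Defs
  imports
    "HOL-Analysis.Finite_Cartesian_Product"
    "HOL-Library.Poly_Mapping"
    "HOL-Library.Set_Algebras"
    "HOL-Library.Extended_Real"
begin

text \<open>
  Polynomials in finitely many variables, indexed by the finite type \<open>'n\<close> (so the number of
  variables is \<open>CARD('n)\<close>): finitely supported maps from exponent vectors to coefficients, with
  the convolution product of \<^theory>\<open>HOL-Library.Poly_Mapping\<close>.
\<close>

type_synonym 'n monom = "'n \<Rightarrow>\<^sub>0 nat"
type_synonym ('n, 'a) mpoly = "'n monom \<Rightarrow>\<^sub>0 'a"

definition const :: "'a::zero \<Rightarrow> ('n, 'a) mpoly" where
  "const c = Poly_Mapping.single 0 c"

definition extend :: "('n, rat) mpoly \<Rightarrow> ('n, 'a::field_char_0) mpoly" where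
  "extend p = Poly_Mapping.map of_rat p"

definition eval :: "'a ^ 'n \<Rightarrow> ('n::finite, 'a::comm_ring_1) mpoly \<Rightarrow> 'a" where
  "eval \<xi> p = (\<Sum>\<alpha>\<in>Poly_Mapping.keys p.
     Poly_Mapping.lookup p \<alpha> * (\<Prod>i\<in>UNIV. (\<xi> $ i) ^ Poly_Mapping.lookup \<alpha> i))"

definition monom_deg :: "('n::finite) monom \<Rightarrow> nat" where
  "monom_deg \<alpha> = (\<Sum>i\<in>UNIV. Poly_Mapping.lookup \<alpha> i)"

text \<open>Total degree; the zero polynomial gets the value 0.\<close>

definition deg :: "('n::finite, 'a::zero) mpoly \<Rightarrow> nat" where
  "deg p = Max (insert 0 (monom_deg ` Poly_Mapping.keys p))"

text \<open>
  The bound is an integer, because bounds such as \<open>d - deg g\<close> may be negative; the zero polynomial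
  satisfies every bound, and is the only one to satisfy a negative bound.
\<close>

definition polys_deg_le :: "int \<Rightarrow> ('n::finite, 'a::zero) mpoly set" where
  "polys_deg_le k = {p. p = 0 \<or> int (deg p) \<le> k}"

text \<open>The ideal generated by a set: the span, with the ring regarded as a module over itself.\<close>

definition ideal_of :: "'r::comm_ring_1 set \<Rightarrow> 'r set" where
  "ideal_of G = module.span (*) G"

definition colon_ideal :: "'r::comm_ring_1 set \<Rightarrow> 'r \<Rightarrow> 'r set" where
  "colon_ideal I g = {h. g * h \<in> I}"

definition zero_dimensional :: "('n::finite, rat) mpoly set \<Rightarrow> bool" where
  "zero_dimensional I \<longleftrightarrow> finite {\<xi> :: complex ^ 'n. \<forall>p\<in>I. eval \<xi> (extend p) = 0}"

definition graded_basis ::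
  "nat \<Rightarrow> (nat \<Rightarrow> ('n::finite, 'a::comm_ring_1) mpoly) \<Rightarrow> ('n, 'a) mpoly set \<Rightarrow> bool" where
  "graded_basis s h I \<longleftrightarrow>
     I = ideal_of (h ` {1..s}) \<and>
     (\<forall>p\<in>I. \<exists>c. p = (\<Sum>j=1..s. c j * h j) \<and>
        (\<forall>j\<in>{1..s}. c j \<in> polys_deg_le (int (deg p) - int (deg (h j)))))"

text \<open>
  \<open>B\<close> is a set of exponent vectors; the polynomials \<open>r\<close> with support in \<open>B\<close> are exactly the linear
  combinations of the monomials in \<open>B\<close>. The two conditions say that the classes of these monomials
  are linearly independent in the quotient by \<open>I\<close>, and that they span it.
\<close>

definition monomial_basis :: "'n monom set \<Rightarrow> ('n, 'a::comm_ring_1) mpoly set \<Rightarrow> bool" where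
  "monomial_basis B I \<longleftrightarrow>
     (\<forall>r. Poly_Mapping.keys r \<subseteq> B \<and> r \<in> I \<longrightarrow> r = 0) \<and>
     (\<forall>p. \<exists>r. Poly_Mapping.keys r \<subseteq> B \<and> p - r \<in> I)"

text \<open>
  The supremum in \<^typ>\<open>enat\<close> is the maximum when \<open>B\<close> is finite and nonempty. A monomial basis of the
  quotient by a zero-dimensional ideal is finite.
\<close>

definition deg_set :: "('n::finite) monom set \<Rightarrow> enat" where
  "deg_set B = (SUP b\<in>B. enat (monom_deg b))"

definition feasible ::
  "nat \<Rightarrow> (nat \<Rightarrow> ('n::finite, rat) mpoly) \<Rightarrow> nat \<Rightarrow> (nat \<Rightarrow> ('n, rat) mpoly) \<Rightarrow> (real ^ 'n) set" where
  "feasible m g s h = {\<xi>. (\<forall>i\<in>{1..m}. eval \<xi> (extend (g i)) \<ge> 0) \<and>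
                           (\<forall>j\<in>{1..s}. eval \<xi> (extend (h j)) = 0)}"

definition sos :: "int \<Rightarrow> ('n::finite, real) mpoly set" where
  "sos k = {\<Sum>i<N. (q i)\<^sup>2 | (N :: nat) q. \<forall>i<N. q i \<in> polys_deg_le (k div 2)}"

text \<open>Sums and multiples of sets are elementwise, as in \<^theory>\<open>HOL-Library.Set_Algebras\<close>.\<close>

definition quadratic_module ::
  "nat \<Rightarrow> (nat \<Rightarrow> ('n::finite, real) mpoly) \<Rightarrow> nat \<Rightarrow> (nat \<Rightarrow> ('n, real) mpoly) \<Rightarrow> int
    \<Rightarrow> ('n, real) mpoly set" where
  "quadratic_module m g s h d =
     sos d
     + (\<Sum>i=1..m. g i *o sos (d - int (deg (g i))))
     + (\<Sum>j=1..s. h j *o polys_deg_le (d - int (deg (h j))))"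

text \<open>The supremum is taken in the extended reals, so that it is \<open>-\<infinity>\<close> for the empty set.\<close>

definition sos_bound ::
  "nat \<Rightarrow> (nat \<Rightarrow> ('n::finite, rat) mpoly) \<Rightarrow> nat \<Rightarrow> (nat \<Rightarrow> ('n, rat) mpoly)
    \<Rightarrow> ('n, rat) mpoly \<Rightarrow> nat \<Rightarrow> ereal" where
  "sos_bound m g s h f l =
     (SUP \<mu>\<in>{\<mu> :: real. extend f - const \<mu>
        \<in> quadratic_module m (\<lambda>i. extend (g i)) s (\<lambda>j. extend (h j)) (2 * int l)}. ereal \<mu>)"

end

theory Submission
  imports Defs
begin

text \<open>
  Write \<open>A\<close> for the quotient of the polynomial ring by \<open>I\<close>, which is finite-dimensional, and
  \<open>F = f - fstar\<close>. The hypothesis provides \<open>u + v F = 1\<close> with \<open>u F \<in> I\<close>, so that \<open>e = v F\<close> is an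
  idempotent of \<open>A\<close> with \<open>e F = F\<close>. On the factor \<open>e A\<close>, which is the quotient by the colon ideal
  \<open>J = (I : F)\<close>, the element \<open>F\<close> is invertible. There nonnegativity on the feasible set becomes
  strict positivity, and Putinar's theorem represents \<open>F\<close> in the quadratic module generated by the
  constraints modulo \<open>J\<close>. Multiplication by \<open>e\<^sup>2\<close> turns this into a representation modulo \<open>I\<close>
  (\<open>nonnegative_in_generated_qmod\<close>).

  Putinar's theorem (\<open>archimedean_positivstellensatz\<close>) holds for quadratic modules in any algebra
  over an archimedean ordered field: an archimedean quadratic module that is maximal among those without
  \<open>- 1\<close> consists of elements that are nonnegative at some real point. Its archimedean hypothesis is automatic in finite
  dimension (\<open>archimedean_if_finite_dimensional\<close>). When \<open>fstar\<close> is rational all this takes place over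
  the rationals, so weights and polynomials come out rational.

  The degrees are bounded by reducing the squared polynomials to the span of \<open>B\<close>; the graded basis
  then controls the multipliers of the \<open>h j\<close> (\<open>sos_certificate\<close>). The hypotheses mix rational and
  real polynomials. Coordinates of the reals as a rational vector space transport them between the
  two fields: one coordinate makes the comaximality relation rational
  (\<open>comaximality_descends\<close>), and all coordinates together show that the graded basis stays graded
  over the reals (\<open>graded_basis_extend\<close>).

  A certificate shows that the bound is at least \<open>fstar\<close>; evaluation at a minimizer shows that it is
  at most \<open>fstar\<close>.
\<close>

text \<open>
  Ideals by their closure properties: these are immediate for colon ideals, which come without
  generators.
\<close>

definition is_ideal :: "'r::comm_ring_1 set \<Rightarrow> bool" where
  "is_ideal J \<longleftrightarrow> 0 \<in> J \<and> (\<forall>a\<in>J. \<forall>b\<in>J. a + b \<in> J) \<and> (\<forall>a. \<forall>b\<in>J. a * b \<in> J)"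

section \<open>Real points and archimedean algebras\<close>

text \<open>
  A real point of a ring is a ring homomorphism to the reals. For a polynomial ring over the
  rationals or over the reals these are exactly the evaluations at points of real affine space, so
  that positivity arguments can be made before any coordinates are chosen.
\<close>

definition real_point :: "('r::comm_ring_1 \<Rightarrow> real) \<Rightarrow> bool" where
  "real_point \<phi> \<longleftrightarrow> (\<forall>a b. \<phi> (a + b) = \<phi> a + \<phi> b) \<and> (\<forall>a b. \<phi> (a * b) = \<phi> a * \<phi> b) \<and> \<phi> 1 = 1"

lemma real_pointD:
  assumes "real_point \<phi>"
  shows "\<phi> (a + b) = \<phi> a + \<phi> b" "\<phi> (a * b) = \<phi> a * \<phi> b" "\<phi> 1 = 1" "\<phi> 0 = 0"
    "\<phi> (- a) = - \<phi> a" "\<phi> (a - b) = \<phi> a - \<phi> b"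
proof -
  show 1: "\<And>a b. \<phi> (a + b) = \<phi> a + \<phi> b" "\<phi> (a * b) = \<phi> a * \<phi> b" "\<phi> 1 = 1"
    using assms by (auto simp: real_point_def)
  show 0: "\<phi> 0 = 0" using 1(1)[of 0 0] by simp
  show m: "\<phi> (- a) = - \<phi> a" for a using 1(1)[of a "- a"] 0 by simp
  show "\<phi> (a - b) = \<phi> a - \<phi> b" using 1(1)[of a "- b"] m[of b] by simp
qed

lemma rat_in_open_interval:
  assumes "(x::real) < y" obtains r where "x < real_of_rat r" "real_of_rat r < y"
  using of_rat_dense[OF assms] by blast

text \<open>
  A commutative algebra over an archimedean ordered field, with \<open>\<kappa>\<close> the structure map. The
  instances of interest are polynomial rings over the rationals and over the reals. Arguing over the
  rationals from the start is what makes the certificate for a rational \<open>fstar\<close> rational.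
\<close>

locale archimedean_algebra =
  fixes \<kappa> :: "'a::archimedean_field \<Rightarrow> 'r::comm_ring_1"
  assumes \<kappa>_add: "\<kappa> (c + d) = \<kappa> c + \<kappa> d"
    and \<kappa>_mult: "\<kappa> (c * d) = \<kappa> c * \<kappa> d"
    and \<kappa>_1 [simp]: "\<kappa> 1 = 1"
begin

lemma \<kappa>_0 [simp]: "\<kappa> 0 = 0"
  using \<kappa>_add[of 0 0] by simp

lemma \<kappa>_minus: "\<kappa> (- c) = - \<kappa> c"
  using \<kappa>_add[of c "- c"] by (simp add: eq_neg_iff_add_eq_0 add.commute)

lemma \<kappa>_diff: "\<kappa> (c - d) = \<kappa> c - \<kappa> d"
  using \<kappa>_add[of c "- d"] by (simp add: \<kappa>_minus)

lemma \<kappa>_sum: "\<kappa> (sum c A) = (\<Sum>x\<in>A. \<kappa> (c x))"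
  by (induction A rule: infinite_finite_induct) (auto simp: \<kappa>_add)

lemma \<kappa>_2: "\<kappa> 2 = 2"
  using \<kappa>_add[of 1 1] by simp

lemma \<kappa>_inverse_cancel: "c \<noteq> 0 \<Longrightarrow> \<kappa> (inverse c) * (\<kappa> c * x) = x"
  by (metis \<kappa>_1 \<kappa>_mult left_inverse mult.assoc mult_1)

section \<open>Quadratic modules and their maximal elements\<close>

text \<open>
  Quadratic modules. Closure under nonnegative scalars is part of the definition because a
  nonnegative element of the field need not be a square; this is why weights appear.
\<close>

definition qmod :: "'r set \<Rightarrow> bool" where
  "qmod M \<longleftrightarrow> 1 \<in> M \<and> (\<forall>a\<in>M. \<forall>b\<in>M. a + b \<in> M) \<and> (\<forall>q. \<forall>a\<in>M. q\<^sup>2 * a \<in> M)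
     \<and> (\<forall>c\<ge>0. \<forall>a\<in>M. \<kappa> c * a \<in> M)"

lemma qmodD:
  assumes "qmod M"
  shows "1 \<in> M" "a \<in> M \<Longrightarrow> b \<in> M \<Longrightarrow> a + b \<in> M" "a \<in> M \<Longrightarrow> q\<^sup>2 * a \<in> M"
    "c \<ge> 0 \<Longrightarrow> a \<in> M \<Longrightarrow> \<kappa> c * a \<in> M" "q\<^sup>2 \<in> M" "c \<ge> 0 \<Longrightarrow> \<kappa> c \<in> M" "0 \<in> M"
proof -
  show 1: "1 \<in> M" "a \<in> M \<Longrightarrow> b \<in> M \<Longrightarrow> a + b \<in> M" "\<And>a q. a \<in> M \<Longrightarrow> q\<^sup>2 * a \<in> M"
    "\<And>a c. c \<ge> 0 \<Longrightarrow> a \<in> M \<Longrightarrow> \<kappa> c * a \<in> M"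
    using assms by (auto simp: qmod_def)
  show "q\<^sup>2 \<in> M" "c \<ge> 0 \<Longrightarrow> \<kappa> c \<in> M" "0 \<in> M"
    using 1(3)[OF 1(1)] 1(4)[OF _ 1(1)] 1(4)[OF order_refl 1(1)] by auto
qed

lemma qmod_sum:
  assumes "qmod M" "\<And>x. x \<in> A \<Longrightarrow> a x \<in> M"
  shows "sum a A \<in> M"
  using assms(2)
  by (induction A rule: infinite_finite_induct) (auto intro: qmodD[OF assms(1)])

lemma qmod_cancel:
  assumes M: "qmod M" and "c > 0" "\<kappa> c * a \<in> M"
  shows "a \<in> M"
  using qmodD(4)[OF M, of "inverse c" "\<kappa> c * a"] assms(2,3) by (simp add: \<kappa>_inverse_cancel)

text \<open>
  Weighted sums of squares, inductively, so that closure properties are proved without concatenating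
  indexed sums; \<open>wsos_explicit\<close> recovers the indexed form.
\<close>

inductive_set wsos :: "'r set" where
  wsos_zero: "0 \<in> wsos"
| wsos_step: "c \<ge> 0 \<Longrightarrow> \<sigma> \<in> wsos \<Longrightarrow> \<kappa> c * q\<^sup>2 + \<sigma> \<in> wsos"

lemma wsos_mult_mem:
  assumes M: "qmod M" and "\<sigma> \<in> wsos" "a \<in> M"
  shows "\<sigma> * a \<in> M"
  using assms(2)
proof induction
  case wsos_zero
  then show ?case using qmodD(7)[OF M] by simp
next
  case (wsos_step c \<sigma> q)
  have "\<kappa> c * (q\<^sup>2 * a) + \<sigma> * a \<in> M"
    using wsos_step \<open>a \<in> M\<close> by (intro qmodD(2-4)[OF M])
  then show ?case by (simp add: algebra_simps)
qed

lemma wsos_subset: "qmod M \<Longrightarrow> wsos \<subseteq> M"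
  using wsos_mult_mem[of M _ 1] by (auto simp: qmodD(1))

lemma qmod_wsos: "qmod wsos"
  unfolding qmod_def
proof (intro conjI ballI allI impI)
  show "1 \<in> wsos"
    using wsos_step[of 1 0 1] by (simp add: wsos_zero)
  show "a + b \<in> wsos" if "a \<in> wsos" "b \<in> wsos" for a b
    using that(1) by induction (auto simp: that(2) add.assoc intro: wsos_step)
  show "q\<^sup>2 * a \<in> wsos" if "a \<in> wsos" for q a
    using that
  proof induction
    case (wsos_step c \<sigma> q')
    then have "\<kappa> c * (q * q')\<^sup>2 + q\<^sup>2 * \<sigma> \<in> wsos"
      by (intro wsos.wsos_step)
    then show ?case by (simp add: algebra_simps power_mult_distrib)
  qed (simp add: wsos_zero)
  show "\<kappa> d * a \<in> wsos" if "a \<in> wsos" "d \<ge> 0" for d a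
    using that(1)
  proof induction
    case (wsos_step c \<sigma> q)
    then have "\<kappa> (d * c) * q\<^sup>2 + \<kappa> d * \<sigma> \<in> wsos"
      using \<open>d \<ge> 0\<close> by (intro wsos.wsos_step) auto
    then show ?case by (simp add: algebra_simps \<kappa>_mult)
  qed (simp add: wsos_zero)
qed

lemma wsos_explicit:
  assumes "\<sigma> \<in> wsos"
  obtains N c q where "\<sigma> = (\<Sum>k<N. \<kappa> (c k) * (q k)\<^sup>2)" "\<And>k. k < (N::nat) \<Longrightarrow> c k \<ge> 0"
proof -
  have "\<exists>(N::nat) c q. \<sigma> = (\<Sum>k<N. \<kappa> (c k) * (q k)\<^sup>2) \<and> (\<forall>k<N. c k \<ge> 0)"
    using assms
  proof induction
    case wsos_zero
    then show ?case by (intro exI[of _ 0]) auto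
  next
    case (wsos_step c0 \<sigma> q0)
    then obtain N :: nat and c q where
      IH: "\<sigma> = (\<Sum>k<N. \<kappa> (c k) * (q k)\<^sup>2)" "\<forall>k<N. c k \<ge> 0"
      by blast
    show ?case
      by (rule exI[of _ "Suc N"], rule exI[of _ "c(N := c0)"], rule exI[of _ "q(N := q0)"])
         (use IH wsos_step in \<open>auto simp: less_Suc_eq\<close>)
  qed
  then show ?thesis using that by blast
qed

text \<open>
  For a quadratic module \<open>M\<close>, the smallest one that contains \<open>M\<close> and \<open>a\<close>.
\<close>

definition adjoin :: "'r set \<Rightarrow> 'r \<Rightarrow> 'r set" where
  "adjoin M a = {x + \<sigma> * a | x \<sigma>. x \<in> M \<and> \<sigma> \<in> wsos}"

lemma adjoinI: "x \<in> M \<Longrightarrow> \<sigma> \<in> wsos \<Longrightarrow> x + \<sigma> * a \<in> adjoin M a"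
  by (auto simp: adjoin_def)

lemma qmod_adjoin:
  assumes M: "qmod M"
  shows "qmod (adjoin M a)" "M \<subseteq> adjoin M a" "a \<in> adjoin M a"
proof -
  note W = qmodD[OF qmod_wsos] and M = qmodD[OF M]
  show sub: "M \<subseteq> adjoin M a"
    using adjoinI[of _ M 0 a] W(7) by auto
  show "a \<in> adjoin M a"
    using adjoinI[of 0 M 1 a] W(1) M(7) by simp
  show "qmod (adjoin M a)"
    unfolding qmod_def
  proof (intro conjI ballI allI impI)
    show "1 \<in> adjoin M a" using sub M(1) by auto
    show "b + c \<in> adjoin M a" if bc: "b \<in> adjoin M a" "c \<in> adjoin M a" for b c
    proof -
      obtain x \<sigma> y \<tau> where *: "x \<in> M" "\<sigma> \<in> wsos" "y \<in> M" "\<tau> \<in> wsos"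
        "b = x + \<sigma> * a" "c = y + \<tau> * a"
        using bc by (auto simp: adjoin_def)
      have "(x + y) + (\<sigma> + \<tau>) * a \<in> adjoin M a"
        using * by (intro adjoinI M(2) W(2))
      then show ?thesis by (simp add: * algebra_simps)
    qed
    show "q\<^sup>2 * b \<in> adjoin M a" if b: "b \<in> adjoin M a" for q b
    proof -
      obtain x \<sigma> where *: "x \<in> M" "\<sigma> \<in> wsos" "b = x + \<sigma> * a"
        using b by (auto simp: adjoin_def)
      have "q\<^sup>2 * x + (q\<^sup>2 * \<sigma>) * a \<in> adjoin M a"
        using * by (intro adjoinI M(3) W(3))
      then show ?thesis by (simp add: * algebra_simps)
    qed
    show "\<kappa> c * b \<in> adjoin M a" if b: "b \<in> adjoin M a" and "c \<ge> 0" for c b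
    proof -
      obtain x \<sigma> where *: "x \<in> M" "\<sigma> \<in> wsos" "b = x + \<sigma> * a"
        using b by (auto simp: adjoin_def)
      have "\<kappa> c * x + (\<kappa> c * \<sigma>) * a \<in> adjoin M a"
        using * \<open>c \<ge> 0\<close> by (intro adjoinI M(4) W(4))
      then show ?thesis by (simp add: * algebra_simps)
    qed
  qed
qed

definition maximal_qmod :: "'r set \<Rightarrow> bool" where
  "maximal_qmod N \<longleftrightarrow> qmod N \<and> - 1 \<notin> N \<and> (\<forall>N'. qmod N' \<and> - 1 \<notin> N' \<and> N \<subseteq> N' \<longrightarrow> N' = N)"

text \<open>
  Zorn's lemma: a union of a chain of quadratic modules avoiding \<open>- 1\<close> is another one.
\<close>

lemma exists_maximal_qmod:
  assumes M: "qmod M" "- 1 \<notin> M"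
  obtains N where "maximal_qmod N" "M \<subseteq> N"
proof -
  define \<A> where "\<A> = {N. qmod N \<and> - 1 \<notin> N \<and> M \<subseteq> N}"
  have "\<exists>N\<in>\<A>. \<forall>X\<in>\<A>. N \<subseteq> X \<longrightarrow> X = N"
  proof (rule subset_Zorn_nonempty)
    show "\<A> \<noteq> {}" using M by (auto simp: \<A>_def)
  next
    fix \<C> assume ne: "\<C> \<noteq> {}" and ch: "subset.chain \<A> \<C>"
    have mem: "qmod N" "- 1 \<notin> N" "M \<subseteq> N" if "N \<in> \<C>" for N
      using that ch by (auto simp: subset.chain_def \<A>_def)
    have "qmod (\<Union>\<C>)"
      unfolding qmod_def
    proof (intro conjI ballI allI impI)
      show "1 \<in> \<Union>\<C>" using ne mem(1) qmodD(1) by auto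
      show "a + b \<in> \<Union>\<C>" if ab: "a \<in> \<Union>\<C>" "b \<in> \<Union>\<C>" for a b
      proof -
        obtain A B where AB: "A \<in> \<C>" "B \<in> \<C>" "a \<in> A" "b \<in> B" using ab by auto
        then have "A \<subseteq> B \<or> B \<subseteq> A" using ch by (auto simp: subset.chain_def)
        then show ?thesis using AB mem(1) qmodD(2) by blast
      qed
      show "q\<^sup>2 * a \<in> \<Union>\<C>" if "a \<in> \<Union>\<C>" for q a
        using that mem(1) qmodD(3) by blast
      show "\<kappa> c * a \<in> \<Union>\<C>" if "a \<in> \<Union>\<C>" "c \<ge> 0" for c a
        using that mem(1) qmodD(4) by blast
    qed
    moreover have "- 1 \<notin> \<Union>\<C>" "M \<subseteq> \<Union>\<C>" using mem(2,3) ne by blast+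
    ultimately show "\<Union>\<C> \<in> \<A>" by (simp add: \<A>_def)
  qed
  then obtain N where "N \<in> \<A>" "\<forall>X\<in>\<A>. N \<subseteq> X \<longrightarrow> X = N" by blast
  then show ?thesis
    by (intro that[of N]) (auto simp: \<A>_def maximal_qmod_def)
qed

text \<open>
  If neither \<open>a\<close> nor \<open>- a\<close> lies in \<open>N\<close>, then adjoining either of them produces \<open>- 1\<close>, which gives
  \<open>- 1 = x + \<sigma> a = y - \<tau> a\<close>. Eliminating \<open>a\<close> shows \<open>- \<sigma> \<in> N\<close>. Since also \<open>\<sigma> \<in> N\<close>, all multiples
  of \<open>\<sigma>\<close> lie in \<open>N\<close>, so the first equation puts \<open>- 1\<close> into \<open>N\<close>.
\<close>

lemma maximal_qmod_total:
  assumes N: "maximal_qmod N"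
  shows "a \<in> N \<or> - a \<in> N"
proof (rule ccontr)
  assume neg: "\<not> ?thesis"
  have q: "qmod N" and m1: "- 1 \<notin> N" using N by (auto simp: maximal_qmod_def)
  note Q = qmodD[OF q]
  have ad: "- 1 \<in> adjoin N b" if "b \<notin> N" for b
    using qmod_adjoin[OF q, of b] that N unfolding maximal_qmod_def by blast
  obtain x \<sigma> where 1: "x \<in> N" "\<sigma> \<in> wsos" "- 1 = x + \<sigma> * a"
    using ad[of a] neg by (auto simp: adjoin_def)
  obtain y \<tau> where 2: "y \<in> N" "\<tau> \<in> wsos" "- 1 = y + \<tau> * (- a)"
    using ad[of "- a"] neg by (auto simp: adjoin_def)
  have W: "\<sigma> \<in> N" "\<tau> \<in> N" using wsos_subset[OF q] 1 2 by auto
  have sum0: "- \<sigma> - \<tau> = \<tau> * x + \<sigma> * y"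
  proof -
    have x: "x = - 1 - \<sigma> * a" and y: "y = - 1 + \<tau> * a"
      using 1(3) 2(3) by (simp_all add: algebra_simps)
    show ?thesis unfolding x y by (simp add: algebra_simps)
  qed
  have "\<tau> * x + \<sigma> * y \<in> N"
    by (intro Q(2) wsos_mult_mem[OF q] 1 2)
  then have "- \<sigma> - \<tau> + \<tau> \<in> N"
    unfolding sum0[symmetric] by (intro Q(2) W)
  then have neg_\<sigma>: "- \<sigma> \<in> N" by simp
  \<comment> \<open>\<open>\<sigma>\<close> and \<open>- \<sigma>\<close> both lie in \<open>N\<close>, hence so does every multiple: \<open>4 a = (a + 1)\<^sup>2 - (a - 1)\<^sup>2\<close>.\<close>
  have "(a + 1)\<^sup>2 * \<sigma> + (a - 1)\<^sup>2 * (- \<sigma>) \<in> N"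
    by (intro Q(2,3) W neg_\<sigma>)
  then have "\<kappa> 4 * (\<sigma> * a) \<in> N"
    using \<kappa>_add[of 2 2] by (simp add: \<kappa>_2 algebra_simps power2_eq_square)
  then have "\<sigma> * a \<in> N" using qmod_cancel[OF q, of 4] by simp
  then have "- 1 \<in> N" unfolding 1(3) by (intro Q(2) 1)
  with m1 show False by simp
qed

text \<open>
  Upper bounds for all elements include lower bounds, through \<open>- a\<close>.
\<close>

definition archimedean :: "'r set \<Rightarrow> bool" where
  "archimedean M \<longleftrightarrow> (\<forall>a. \<exists>c. \<kappa> c - a \<in> M)"

abbreviation \<rho> :: "rat \<Rightarrow> 'r" where "\<rho> r \<equiv> \<kappa> (of_rat r)"

text \<open>
  A maximal proper quadratic module \<open>N\<close> is the nonnegativity cone of a point. Because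
  \<open>N \<union> - N\<close> is everything, each \<open>a\<close> defines a Dedekind cut of the rationals \<open>r\<close> according to
  whether \<open>r - a \<in> N\<close> or \<open>a - r \<in> N\<close>; the archimedean property makes the cut a real number \<open>\<phi> a\<close>.
  Additivity is the addition of cuts. For multiplicativity it suffices to treat squares, by
  polarization, and rational bounds on \<open>a\<close> transfer to \<open>a\<^sup>2\<close> by two identities in \<open>N\<close>.
\<close>

lemma maximal_qmod_real_point:
  assumes N: "maximal_qmod N" and arch: "archimedean N"
  obtains \<phi> where "real_point \<phi>" "\<And>a. a \<in> N \<Longrightarrow> \<phi> a \<ge> 0"
proof -
  have q: "qmod N" and m1: "- 1 \<notin> N" using N by (auto simp: maximal_qmod_def)
  note Q = qmodD[OF q]
  define U where "U a = {real_of_rat r | r. \<rho> r - a \<in> N}" for a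
  define \<phi> where "\<phi> a = Inf (U a)" for a
  have scalar: "c \<ge> 0" if "\<kappa> c \<in> N" for c
  proof (rule ccontr)
    assume c: "\<not> c \<ge> 0"
    then have "\<kappa> (inverse (- c)) * \<kappa> c \<in> N" by (intro Q(4) that) auto
    moreover have "\<kappa> (inverse (- c)) * \<kappa> c = - 1"
      using c by (simp add: \<kappa>_mult[symmetric] \<kappa>_minus)
    ultimately show False using m1 by simp
  qed
  have below: "r \<le> s" if "a - \<rho> r \<in> N" "\<rho> s - a \<in> N" for a r s
  proof -
    have "\<kappa> (of_rat s - of_rat r) \<in> N"
      using Q(2)[OF that] by (simp add: \<kappa>_diff)
    then show ?thesis using scalar by (metis diff_ge_0_iff_ge of_rat_less_eq)
  qed
  have up: "\<exists>r. \<rho> r - a \<in> N" for a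
  proof -
    obtain c where c: "\<kappa> c - a \<in> N" using arch by (auto simp: archimedean_def)
    obtain z where z: "c \<le> of_int z" using ex_le_of_int by blast
    have "\<kappa> c - a + \<kappa> (of_int z - c) \<in> N" by (intro Q(2) c Q(6)) (use z in auto)
    then show ?thesis by (intro exI[of _ "of_int z"]) (simp add: \<kappa>_diff)
  qed
  have down: "\<exists>r. a - \<rho> r \<in> N" for a
  proof -
    obtain r where "\<rho> r - (- a) \<in> N" using up by blast
    then show ?thesis
      by (intro exI[of _ "- r"]) (simp add: of_rat_minus \<kappa>_minus add.commute)
  qed
  have bdd: "bdd_below (U a)" for a
  proof -
    obtain r where r: "a - \<rho> r \<in> N" using down by blast
    show ?thesis
      by (rule bdd_belowI[of _ "real_of_rat r"]) (auto simp: U_def of_rat_less_eq intro: below[OF r])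
  qed
  have le: "\<phi> a \<le> real_of_rat r" if "\<rho> r - a \<in> N" for a r
    unfolding \<phi>_def using that by (intro cInf_lower bdd) (auto simp: U_def)
  have ge: "real_of_rat r \<le> \<phi> a" if "a - \<rho> r \<in> N" for a r
    unfolding \<phi>_def using up[of a] that
    by (intro cInf_greatest) (auto simp: U_def of_rat_less_eq intro: below)
  have lt: "\<rho> r - a \<in> N" if "\<phi> a < real_of_rat r" for a r
    using maximal_qmod_total[OF N, of "\<rho> r - a"] ge[of a r] that by auto
  have gt: "a - \<rho> r \<in> N" if "real_of_rat r < \<phi> a" for a r
    using maximal_qmod_total[OF N, of "\<rho> r - a"] le[of r a] that by auto
  have \<rho>_add: "\<rho> (r + s) = \<rho> r + \<rho> s" for r s by (simp add: of_rat_add \<kappa>_add)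
  have add: "\<phi> (a + b) = \<phi> a + \<phi> b" for a b
  proof (rule antisym)
    show "\<phi> (a + b) \<le> \<phi> a + \<phi> b"
    proof (rule ccontr)
      assume "\<not> ?thesis"
      then have "\<phi> a < \<phi> (a + b) - \<phi> b" by simp
      then obtain r where r: "\<phi> a < real_of_rat r" "real_of_rat r < \<phi> (a + b) - \<phi> b"
        using rat_in_open_interval by blast
      then have "\<phi> b < \<phi> (a + b) - real_of_rat r" by simp
      then obtain s where s: "\<phi> b < real_of_rat s" "real_of_rat s < \<phi> (a + b) - real_of_rat r"
        using rat_in_open_interval by blast
      have "(\<rho> r - a) + (\<rho> s - b) \<in> N" by (intro Q(2) lt r s)
      then have "\<rho> (r + s) - (a + b) \<in> N" unfolding \<rho>_add by (simp add: algebra_simps)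
      from le[OF this] s show False by (simp add: of_rat_add)
    qed
    show "\<phi> a + \<phi> b \<le> \<phi> (a + b)"
    proof (rule ccontr)
      assume "\<not> ?thesis"
      then have "\<phi> (a + b) - \<phi> b < \<phi> a" by simp
      then obtain r where r: "real_of_rat r < \<phi> a" "\<phi> (a + b) - \<phi> b < real_of_rat r"
        using rat_in_open_interval by blast
      then have "\<phi> (a + b) - real_of_rat r < \<phi> b" by simp
      then obtain s where s: "real_of_rat s < \<phi> b" "\<phi> (a + b) - real_of_rat r < real_of_rat s"
        using rat_in_open_interval by blast
      have "(a - \<rho> r) + (b - \<rho> s) \<in> N" by (intro Q(2) gt r s)
      then have "(a + b) - \<rho> (r + s) \<in> N" unfolding \<rho>_add by (simp add: algebra_simps)
      from ge[OF this] s show False by (simp add: of_rat_add)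
    qed
  qed
  have zero: "\<phi> 0 = 0" using add[of 0 0] by simp
  have minus: "\<phi> (- a) = - \<phi> a" for a using add[of a "- a"] zero by simp
  have one: "\<phi> 1 = 1"
    using le[of 1 1] ge[of 1 1] Q(7) by simp
  have nonneg: "\<phi> a \<ge> 0" if "a \<in> N" for a
    using ge[of a 0] that by simp
  have sq_le: "\<phi> (a\<^sup>2) \<le> (\<phi> a)\<^sup>2" for a
  proof (rule ccontr)
    assume "\<not> ?thesis"
    then have "\<bar>\<phi> a\<bar> < sqrt (\<phi> (a\<^sup>2))" by (simp add: real_less_rsqrt)
    then obtain s where s: "\<bar>\<phi> a\<bar> < real_of_rat s" "real_of_rat s < sqrt (\<phi> (a\<^sup>2))"
      using rat_in_open_interval by blast
    have s0: "s > 0" using s(1) by (metis abs_ge_zero le_less_trans zero_less_of_rat_iff)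
    have 1: "\<rho> s - a \<in> N" "\<rho> s - (- a) \<in> N"
      using s(1) by (intro lt; simp add: minus)+
    \<comment> \<open>\<open>2 s (s\<^sup>2 - a\<^sup>2) = (s + a)\<^sup>2 (s - a) + (s - a)\<^sup>2 (s + a)\<close>\<close>
    have "(\<rho> s + a)\<^sup>2 * (\<rho> s - a) + (\<rho> s - a)\<^sup>2 * (\<rho> s - (- a)) \<in> N"
      by (intro Q(2,3) 1)
    also have "(\<rho> s + a)\<^sup>2 * (\<rho> s - a) + (\<rho> s - a)\<^sup>2 * (\<rho> s - (- a))
        = \<kappa> (2 * of_rat s) * (\<rho> (s\<^sup>2) - a\<^sup>2)"
      by (simp add: \<kappa>_mult \<kappa>_2 of_rat_mult power2_eq_square algebra_simps)
    finally have "\<rho> (s\<^sup>2) - a\<^sup>2 \<in> N"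
      by (rule qmod_cancel[OF q, rotated]) (use s0 in simp)
    then have "\<phi> (a\<^sup>2) \<le> (real_of_rat s)\<^sup>2" using le by (metis of_rat_power)
    moreover have "(real_of_rat s)\<^sup>2 < \<phi> (a\<^sup>2)"
    proof -
      have "(real_of_rat s)\<^sup>2 < (sqrt (\<phi> (a\<^sup>2)))\<^sup>2"
        using s s0 by (intro power_strict_mono) auto
      then show ?thesis using nonneg[OF Q(5)[of a]] by simp
    qed
    ultimately show False by simp
  qed
  have sq_ge_pos: "(\<phi> a)\<^sup>2 \<le> \<phi> (a\<^sup>2)" if "\<phi> a \<ge> 0" for a
  proof (rule ccontr)
    assume "\<not> ?thesis"
    then have "sqrt (\<phi> (a\<^sup>2)) < \<phi> a"
      using that by (intro real_less_lsqrt) auto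
    then obtain r where r: "sqrt (\<phi> (a\<^sup>2)) < real_of_rat r" "real_of_rat r < \<phi> a"
      using rat_in_open_interval by blast
    have r0: "r > 0"
      using r(1) nonneg[OF Q(5)[of a]] by (metis le_less_trans real_sqrt_ge_zero zero_less_of_rat_iff)
    \<comment> \<open>\<open>a\<^sup>2 - r\<^sup>2 = (a - r)\<^sup>2 + 2 r (a - r)\<close>\<close>
    have "(a - \<rho> r)\<^sup>2 + \<kappa> (2 * of_rat r) * (a - \<rho> r) \<in> N"
      by (intro Q(2,4,5) gt r) (use r0 in auto)
    also have "(a - \<rho> r)\<^sup>2 + \<kappa> (2 * of_rat r) * (a - \<rho> r) = a\<^sup>2 - \<rho> (r\<^sup>2)"
      by (simp add: \<kappa>_mult \<kappa>_2 of_rat_mult power2_eq_square algebra_simps)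
    finally have "(real_of_rat r)\<^sup>2 \<le> \<phi> (a\<^sup>2)" using ge by (metis of_rat_power)
    then show False using r(1) r0 by (simp add: real_le_rsqrt leD)
  qed
  have sq: "\<phi> (a\<^sup>2) = (\<phi> a)\<^sup>2" for a
    using sq_le[of a] sq_ge_pos[of a] sq_ge_pos[of "- a"] by (cases "\<phi> a \<ge> 0") (auto simp: minus)
  have mult: "\<phi> (a * b) = \<phi> a * \<phi> b" for a b
  proof -
    have "(a + b)\<^sup>2 = a\<^sup>2 + b\<^sup>2 + (a * b + a * b)" by (simp add: power2_eq_square algebra_simps)
    then have "(\<phi> a + \<phi> b)\<^sup>2 = (\<phi> a)\<^sup>2 + (\<phi> b)\<^sup>2 + 2 * \<phi> (a * b)"
      by (metis add sq mult_2)
    then show ?thesis by (simp add: power2_eq_square algebra_simps)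
  qed
  show ?thesis
    using that[of \<phi>] add mult one nonneg by (auto simp: real_point_def)
qed

section \<open>Positivity implies membership\<close>

text \<open>
  The theorem of Putinar and Jacobi. If \<open>- 1\<close> could not be written as \<open>x - p F\<close> with \<open>x \<in> M\<close> and \<open>p\<close>
  a sum of squares, a maximal quadratic module containing \<open>M\<close> and \<open>- F\<close> would give a point with
  \<open>\<phi> F \<le> 0\<close>. Hence \<open>p F - 1 \<in> M\<close>. The factor \<open>p\<close> is removed by lowering the constant in
  \<open>F + r \<in> M\<close> by the fixed amount \<open>\<delta> = 1 / k\<^sup>2\<close> as long as \<open>r \<ge> 0\<close>, starting from an
  \<open>r\<close> that exists by the archimedean property.
\<close>

theorem archimedean_positivstellensatz:
  assumes M: "qmod M" and arch: "archimedean M"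
    and pos: "\<And>\<phi>. real_point \<phi> \<Longrightarrow> (\<And>a. a \<in> M \<Longrightarrow> \<phi> a \<ge> 0) \<Longrightarrow> \<phi> F > 0"
  shows "F \<in> M"
proof -
  note Q = qmodD[OF M]
  have "- 1 \<in> adjoin M (- F)"
  proof (rule ccontr)
    assume "- 1 \<notin> adjoin M (- F)"
    then obtain N where N: "maximal_qmod N" "adjoin M (- F) \<subseteq> N"
      using exists_maximal_qmod qmod_adjoin(1)[OF M] by metis
    have MN: "M \<subseteq> N" and FN: "- F \<in> N" using N(2) qmod_adjoin(2,3)[OF M, of "- F"] by auto
    have "archimedean N" using arch MN by (auto simp: archimedean_def)
    then obtain \<phi> where \<phi>: "real_point \<phi>" "\<And>a. a \<in> N \<Longrightarrow> \<phi> a \<ge> 0"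
      using maximal_qmod_real_point N(1) by blast
    then have "\<phi> F > 0" using pos MN by blast
    with \<phi>(2)[OF FN] show False by (simp add: real_pointD[OF \<phi>(1)])
  qed
  then obtain x p where x: "x \<in> M" and p: "p \<in> wsos" and xp: "- 1 = x + p * (- F)"
    by (auto simp: adjoin_def)
  have pF: "p * F - 1 \<in> M" using x xp by (simp add: algebra_simps)
  have pM: "p \<in> M" using wsos_subset[OF M] p by auto
  have bound: "\<exists>c. \<forall>d\<ge>c. \<kappa> d - a \<in> M" for a
  proof -
    obtain c where c: "\<kappa> c - a \<in> M" using arch by (auto simp: archimedean_def)
    have "\<kappa> d - a \<in> M" if "d \<ge> c" for d
      using Q(2)[OF c Q(6)[of "d - c"]] that by (simp add: \<kappa>_diff)
    then show ?thesis by blast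
  qed
  obtain c1 c2 c3 where c: "\<And>d. d \<ge> c1 \<Longrightarrow> \<kappa> d - p \<in> M" "\<And>d. d \<ge> c2 \<Longrightarrow> \<kappa> d - (1 + p\<^sup>2 * F) \<in> M"
    "\<And>d. d \<ge> c3 \<Longrightarrow> \<kappa> d - (- F) \<in> M"
    using bound[of p] bound[of "1 + p\<^sup>2 * F"] bound[of "- F"] by metis
  define k where "k = max 1 (max c1 c2)"
  have k: "k \<ge> 1" "2 * k \<ge> c1" "2 * k \<ge> c2" by (auto simp: k_def)
  have K1: "\<kappa> (2 * k) - p \<in> M" and K2: "\<kappa> (2 * k) - (1 + p\<^sup>2 * F) \<in> M"
    using c(1,2) k by auto
  have K3: "p * (\<kappa> (2 * k) - p) \<in> M" using wsos_mult_mem[OF M p K1] .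
  define \<delta> where "\<delta> = inverse (k\<^sup>2)"
  have \<delta>: "\<delta> > 0" "k\<^sup>2 * \<delta> = 1" using k by (auto simp: \<delta>_def)
  have step: "F + \<kappa> (r - \<delta>) \<in> M" if r: "r \<ge> 0" "F + \<kappa> r \<in> M" for r
  proof -
    \<comment> \<open>This sum equals \<open>k\<^sup>2 (F + r) - 1\<close>: all terms containing \<open>p\<close> cancel.\<close>
    have "(\<kappa> k - p)\<^sup>2 * (F + \<kappa> r) + \<kappa> (2 * k) * (p * F - 1) + \<kappa> r * (p * (\<kappa> (2 * k) - p))
        + (\<kappa> (2 * k) - (1 + p\<^sup>2 * F)) \<in> M"
      using k by (intro Q(2-4) K2 K3 pF r) auto
    also have "(\<kappa> k - p)\<^sup>2 * (F + \<kappa> r) + \<kappa> (2 * k) * (p * F - 1) + \<kappa> r * (p * (\<kappa> (2 * k) - p))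
        + (\<kappa> (2 * k) - (1 + p\<^sup>2 * F)) = \<kappa> (k\<^sup>2) * F + \<kappa> (k\<^sup>2) * \<kappa> r - \<kappa> (k\<^sup>2 * \<delta>)"
      unfolding \<delta> by (simp add: \<kappa>_mult \<kappa>_2 power2_eq_square algebra_simps)
    also have "\<dots> = \<kappa> (k\<^sup>2) * (F + \<kappa> (r - \<delta>))"
      by (simp add: \<kappa>_mult \<kappa>_diff algebra_simps)
    finally show ?thesis by (rule qmod_cancel[OF M, rotated]) (use k in simp)
  qed
  define c0 where "c0 = max 0 c3"
  have descent: "F + \<kappa> (max 0 (c0 - of_nat n * \<delta>)) \<in> M" for n
  proof (induction n)
    case 0
    then show ?case using c(3)[of c0] by (simp add: c0_def add.commute)
  next
    case (Suc n)
    define r where "r = max 0 (c0 - of_nat n * \<delta>)"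
    define r' where "r' = max 0 (c0 - of_nat (Suc n) * \<delta>)"
    have "r' \<ge> r - \<delta>" using \<delta>(1) by (auto simp: r_def r'_def algebra_simps max_def)
    then have "\<kappa> (r' - (r - \<delta>)) \<in> M" by (intro Q(6)) simp
    moreover have "F + \<kappa> (r - \<delta>) \<in> M" using Suc by (intro step) (auto simp: r_def)
    ultimately have "(F + \<kappa> (r - \<delta>)) + \<kappa> (r' - (r - \<delta>)) \<in> M" using Q(2) by blast
    then show ?case by (simp add: \<kappa>_diff r'_def)
  qed
  obtain n where "c0 / \<delta> < of_nat n" using reals_Archimedean2 by blast
  then have "max 0 (c0 - of_nat n * \<delta>) = 0" using \<delta> by (simp add: field_simps)
  then show ?thesis using descent[of n] by simp
qed

definition spans_mod :: "'r set \<Rightarrow> 'r set \<Rightarrow> bool" where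
  "spans_mod B I \<longleftrightarrow> (\<forall>a. \<exists>c. a - (\<Sum>b\<in>B. \<kappa> (c b) * b) \<in> I)"

text \<open>
  In a finite-dimensional quotient every quadratic module is archimedean. Let \<open>s\<close> be the sum of the
  squares of the spanning elements. By the parallelogram law every square is at most a multiple of
  \<open>s\<close> with respect to \<open>M\<close>; this applies to the squares \<open>(a b)\<^sup>2\<close> whose sum is \<open>s\<^sup>2\<close>, and gives
  \<open>K s - s\<^sup>2 \<in> M\<close>. Then \<open>K (K - s) = (K - s)\<^sup>2 + (K s - s\<^sup>2)\<close> shows that \<open>s\<close> itself is at most
  \<open>K\<close>. So squares are bounded by scalars, and \<open>a \<le> (a\<^sup>2 + 1) / 2\<close> bounds all elements.
\<close>

lemma archimedean_if_finite_dimensional: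
  assumes M: "qmod M" and I: "I \<subseteq> M" "\<And>a p. p \<in> I \<Longrightarrow> a * p \<in> I"
    and B: "finite B" "spans_mod B I"
  shows "archimedean M"
proof -
  note Q = qmodD[OF M]
  define s where "s = (\<Sum>b\<in>B. b\<^sup>2)"
  have s: "s \<in> M" unfolding s_def by (intro qmod_sum[OF M] Q(5))
  define dom where "dom a \<longleftrightarrow> (\<exists>C\<ge>0. \<kappa> C * s - a\<^sup>2 \<in> M)" for a
  have dom_I: "dom p" if "p \<in> I" for p
  proof -
    have "(- p) * p \<in> M" using I that by blast
    then show ?thesis unfolding dom_def by (intro exI[of _ 0]) (simp add: power2_eq_square)
  qed
  have dom_add: "dom (a + b)" if ab: "dom a" "dom b" for a b
  proof -
    obtain C D where C: "C \<ge> 0" "\<kappa> C * s - a\<^sup>2 \<in> M" and D: "D \<ge> 0" "\<kappa> D * s - b\<^sup>2 \<in> M"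
      using ab unfolding dom_def by blast
    have "\<kappa> 2 * ((\<kappa> C * s - a\<^sup>2) + (\<kappa> D * s - b\<^sup>2)) + (a - b)\<^sup>2 \<in> M"
      using C D by (intro Q(2,4,5)) auto
    also have "\<kappa> 2 * ((\<kappa> C * s - a\<^sup>2) + (\<kappa> D * s - b\<^sup>2)) + (a - b)\<^sup>2
      = \<kappa> (2 * (C + D)) * s - (a + b)\<^sup>2"
      by (simp add: \<kappa>_2 \<kappa>_mult \<kappa>_add power2_eq_square algebra_simps)
    finally show ?thesis
      unfolding dom_def using C D by (intro exI[of _ "2 * (C + D)"]) auto
  qed
  have dom_scale: "dom (\<kappa> c * a)" if a: "dom a" for c a
  proof -
    obtain C where C: "C \<ge> 0" "\<kappa> C * s - a\<^sup>2 \<in> M" using a unfolding dom_def by blast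
    have "\<kappa> (c\<^sup>2) * (\<kappa> C * s - a\<^sup>2) \<in> M" using C by (intro Q(4)) auto
    then show ?thesis
      unfolding dom_def using C
      by (intro exI[of _ "c\<^sup>2 * C"]) (auto simp: \<kappa>_mult power2_eq_square algebra_simps)
  qed
  have dom_0: "dom 0" unfolding dom_def by (intro exI[of _ 0]) (simp add: Q(7))
  have dom_B: "dom b" if "b \<in> B" for b
  proof -
    have "(\<Sum>b\<in>B - {b}. b\<^sup>2) \<in> M" by (intro qmod_sum[OF M] Q(5))
    then show ?thesis
      unfolding dom_def by (intro exI[of _ 1]) (simp add: s_def sum.remove[OF B(1) that])
  qed
  have dom_sum: "dom (\<Sum>b\<in>A. \<kappa> (c b) * b)" if "A \<subseteq> B" for A c
    using that by (induction A rule: infinite_finite_induct) (auto simp: dom_0 intro: dom_add[OF dom_scale[OF dom_B]])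
  have dom: "dom a" for a
  proof -
    obtain c where "a - (\<Sum>b\<in>B. \<kappa> (c b) * b) \<in> I" using B(2) by (auto simp: spans_mod_def)
    from dom_add[OF dom_I[OF this] dom_sum[OF order_refl, of c]] show ?thesis by simp
  qed
  obtain C where C: "\<And>a. C a \<ge> 0" "\<And>a. \<kappa> (C a) * s - a\<^sup>2 \<in> M"
    using dom unfolding dom_def by metis
  \<comment> \<open>The summand 1 makes \<open>K\<close> positive, so that it can be cancelled.\<close>
  define K where "K = (\<Sum>a\<in>B. \<Sum>b\<in>B. C (a * b)) + 1"
  have K: "K > 0" unfolding K_def using C(1) by (intro add_nonneg_pos sum_nonneg) auto
  have "(\<Sum>a\<in>B. \<Sum>b\<in>B. \<kappa> (C (a * b)) * s - (a * b)\<^sup>2) + s \<in> M"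
    by (intro Q(2) s qmod_sum[OF M] C)
  also have "(\<Sum>a\<in>B. \<Sum>b\<in>B. \<kappa> (C (a * b)) * s - (a * b)\<^sup>2) + s = \<kappa> K * s - s\<^sup>2"
  proof -
    have "s\<^sup>2 = (\<Sum>a\<in>B. \<Sum>b\<in>B. (a * b)\<^sup>2)"
      by (simp add: s_def power2_eq_square[of "sum _ _"] sum_product power_mult_distrib)
    then show ?thesis
      by (simp add: K_def sum_subtractf \<kappa>_add \<kappa>_sum sum_distrib_left algebra_simps)
  qed
  finally have "\<kappa> K * s - s\<^sup>2 + (\<kappa> K - s)\<^sup>2 \<in> M" by (intro Q(2,5))
  then have "\<kappa> K * (\<kappa> K - s) \<in> M" by (simp add: power2_eq_square algebra_simps)
  then have Ks: "\<kappa> K - s \<in> M" by (rule qmod_cancel[OF M K])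
  show ?thesis
    unfolding archimedean_def
  proof (intro allI exI)
    fix a
    have "\<kappa> (1/2) * ((\<kappa> (C a) * s - a\<^sup>2) + \<kappa> (C a) * (\<kappa> K - s) + (1 - a)\<^sup>2) \<in> M"
      by (intro Q(2,4,5) C Ks) auto
    also have "(\<kappa> (C a) * s - a\<^sup>2) + \<kappa> (C a) * (\<kappa> K - s) + (1 - a)\<^sup>2
      = \<kappa> (C a * K) + \<kappa> 1 - \<kappa> 2 * a"
      by (simp add: \<kappa>_mult \<kappa>_2 power2_eq_square algebra_simps)
    also have "\<kappa> (1/2) * \<dots> = \<kappa> ((C a * K + 1) / 2) - \<kappa> (1/2 * 2) * a"
      by (simp only: \<kappa>_mult[symmetric] \<kappa>_add[symmetric] distrib_left right_diff_distrib mult.assoc[symmetric])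
         (simp add: field_simps)
    finally show "\<kappa> ((C a * K + 1) / 2) - a \<in> M" by simp
  qed
qed

text \<open>
  The convention \<open>g 0 = 1\<close> makes the plain sum of squares the summand with index 0, so that the
  sum of squares and the multiples of the constraints are treated alike.
\<close>

definition generated_qmod :: "nat \<Rightarrow> (nat \<Rightarrow> 'r) \<Rightarrow> 'r set \<Rightarrow> 'r set" where
  "generated_qmod m g J = {(\<Sum>i\<le>m. \<sigma> i * g i) + p | \<sigma> p. (\<forall>i\<le>m. \<sigma> i \<in> wsos) \<and> p \<in> J}"

lemma generated_qmod:
  assumes g0: "g 0 = 1" and J: "is_ideal J"
  shows "qmod (generated_qmod m g J)" "J \<subseteq> generated_qmod m g J"
    "i \<le> m \<Longrightarrow> g i \<in> generated_qmod m g J"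
proof -
  note W = qmodD[OF qmod_wsos]
  have intro: "(\<Sum>i\<le>m. \<sigma> i * g i) + p \<in> generated_qmod m g J"
    if "\<And>i. i \<le> m \<Longrightarrow> \<sigma> i \<in> wsos" "p \<in> J" for \<sigma> p
    using that by (auto simp: generated_qmod_def)
  show J_sub: "J \<subseteq> generated_qmod m g J"
    using intro[of "\<lambda>_. 0"] W(7) by auto
  show gen: "g i \<in> generated_qmod m g J" if "i \<le> m" for i
    using intro[of "\<lambda>k. if k = i then 1 else 0" 0] W(1,7) J that
    by (auto simp: is_ideal_def if_distrib[of "\<lambda>x. x * _"] cong: if_cong)
  show "qmod (generated_qmod m g J)"
    unfolding qmod_def
  proof (intro conjI ballI allI impI)
    show "1 \<in> generated_qmod m g J" using gen[of 0] g0 by simp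
    show "a + b \<in> generated_qmod m g J"
      if ab: "a \<in> generated_qmod m g J" "b \<in> generated_qmod m g J" for a b
    proof -
      obtain \<sigma> p \<tau> r where *: "\<forall>i\<le>m. \<sigma> i \<in> wsos" "p \<in> J" "\<forall>i\<le>m. \<tau> i \<in> wsos" "r \<in> J"
        "a = (\<Sum>i\<le>m. \<sigma> i * g i) + p" "b = (\<Sum>i\<le>m. \<tau> i * g i) + r"
        using ab by (auto simp: generated_qmod_def)
      have "(\<Sum>i\<le>m. (\<sigma> i + \<tau> i) * g i) + (p + r) \<in> generated_qmod m g J"
        using * J by (intro intro W(2)) (auto simp: is_ideal_def)
      then show ?thesis by (simp add: * algebra_simps sum.distrib)
    qed
    show "q\<^sup>2 * a \<in> generated_qmod m g J" if a: "a \<in> generated_qmod m g J" for q a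
    proof -
      obtain \<sigma> p where *: "\<forall>i\<le>m. \<sigma> i \<in> wsos" "p \<in> J" "a = (\<Sum>i\<le>m. \<sigma> i * g i) + p"
        using a by (auto simp: generated_qmod_def)
      have "(\<Sum>i\<le>m. (q\<^sup>2 * \<sigma> i) * g i) + q\<^sup>2 * p \<in> generated_qmod m g J"
        using * J by (intro intro W(3)) (auto simp: is_ideal_def)
      then show ?thesis by (simp add: * algebra_simps sum_distrib_left)
    qed
    show "\<kappa> c * a \<in> generated_qmod m g J" if a: "a \<in> generated_qmod m g J" and "c \<ge> 0" for c a
    proof -
      obtain \<sigma> p where *: "\<forall>i\<le>m. \<sigma> i \<in> wsos" "p \<in> J" "a = (\<Sum>i\<le>m. \<sigma> i * g i) + p"
        using a by (auto simp: generated_qmod_def)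
      have "(\<Sum>i\<le>m. (\<kappa> c * \<sigma> i) * g i) + \<kappa> c * p \<in> generated_qmod m g J"
        using * J \<open>c \<ge> 0\<close> by (intro intro W(4)) (auto simp: is_ideal_def)
      then show ?thesis by (simp add: * algebra_simps sum_distrib_left)
    qed
  qed
qed

text \<open>
  The comaximality condition reduces nonnegativity to strict positivity. Let \<open>J = (I : F)\<close>. A real
  point that vanishes on \<open>J\<close> sends \<open>u\<close> to 0, hence cannot send \<open>F\<close> to 0, so nonnegativity there is
  strict and \<open>F\<close> has a representation modulo \<open>J\<close>. Multiply that representation by the square of
  \<open>e = v F\<close>: the remainder in \<open>J\<close> gets into \<open>I\<close> because \<open>F J \<subseteq> I\<close>, and \<open>F\<close> is unchanged modulo \<open>I\<close>
  because \<open>(1 - e) F = u F \<in> I\<close>.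
\<close>

theorem nonnegative_in_generated_qmod:
  assumes I: "is_ideal I" and B: "finite B" "spans_mod B I" and g0: "g 0 = 1"
    and comax: "u + v * F = 1" "F * u \<in> I"
    and nonneg: "\<And>\<phi>. real_point \<phi> \<Longrightarrow> (\<And>p. p \<in> I \<Longrightarrow> \<phi> p = 0) \<Longrightarrow>
      (\<And>i. i \<le> m \<Longrightarrow> \<phi> (g i) \<ge> 0) \<Longrightarrow> \<phi> F \<ge> 0"
  shows "F \<in> generated_qmod m g I"
proof -
  define J where "J = colon_ideal I F"
  have IJ: "I \<subseteq> J" and J: "is_ideal J" and uJ: "u \<in> J"
    using I comax(2)
    by (auto simp: J_def colon_ideal_def is_ideal_def distrib_left mult.left_commute[of F])
  define M where "M = generated_qmod m g J"
  note gen = generated_qmod(1,2)[of g J m, OF g0 J, folded M_def]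
  have gM: "g i \<in> M" if "i \<le> m" for i
    unfolding M_def using that by (rule generated_qmod(3)[of g, OF g0 J])
  have "spans_mod B J" using B(2) IJ by (fastforce simp: spans_mod_def)
  then have arch: "archimedean M"
    using J by (intro archimedean_if_finite_dimensional[OF gen(1,2) _ B(1)]) (auto simp: is_ideal_def)
  have "F \<in> M"
  proof (rule archimedean_positivstellensatz[OF gen(1) arch])
    fix \<phi> assume \<phi>: "real_point \<phi>" and pos: "\<And>a. a \<in> M \<Longrightarrow> \<phi> a \<ge> 0"
    have zero: "\<phi> p = 0" if "p \<in> J" for p
    proof -
      have "- p \<in> J" using J that by (metis is_ideal_def mult_minus1)
      then have "\<phi> p \<ge> 0" "\<phi> (- p) \<ge> 0" using that gen(2) pos by blast+
      then show ?thesis by (simp add: real_pointD[OF \<phi>])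
    qed
    have "\<phi> F \<ge> 0" using IJ zero gM pos by (intro nonneg[OF \<phi>]) auto
    moreover have "\<phi> F \<noteq> 0"
      using arg_cong[OF comax(1), of \<phi>] zero[OF uJ] by (auto simp: real_pointD[OF \<phi>])
    ultimately show "\<phi> F > 0" by simp
  qed
  then obtain \<sigma> j where *: "\<forall>i\<le>m. \<sigma> i \<in> wsos" "j \<in> J" "F = (\<Sum>i\<le>m. \<sigma> i * g i) + j"
    by (auto simp: M_def generated_qmod_def)
  define e where "e = v * F"
  have e: "e = 1 - u" using comax(1) by (simp add: e_def algebra_simps)
  define p where "p = (1 + e) * (F * u) + v\<^sup>2 * F * (F * j)"
  have "p \<in> I"
    unfolding p_def using comax(2) *(2) I by (auto simp: is_ideal_def J_def colon_ideal_def)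
  moreover have "F = (\<Sum>i\<le>m. (e\<^sup>2 * \<sigma> i) * g i) + p"
  proof -
    have "F = e\<^sup>2 * F + (1 + e) * (1 - e) * F" by (simp add: power2_eq_square algebra_simps)
    also have "e\<^sup>2 * F = e\<^sup>2 * (\<Sum>i\<le>m. \<sigma> i * g i) + v\<^sup>2 * F * (F * j)"
      by (subst (1) *(3)) (simp add: e_def power2_eq_square algebra_simps)
    finally show ?thesis
      by (simp add: p_def e algebra_simps sum_distrib_left)
  qed
  moreover have "\<forall>i\<le>m. e\<^sup>2 * \<sigma> i \<in> wsos"
    using *(1) qmodD(3)[OF qmod_wsos] by blast
  ultimately show ?thesis unfolding generated_qmod_def mem_Collect_eq
    by (intro exI[of _ "\<lambda>i. e\<^sup>2 * \<sigma> i"] exI[of _ p]) simp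
qed

end

section \<open>Ideals\<close>

lemma module_times: "module ((*) :: 'r::comm_ring_1 \<Rightarrow> 'r \<Rightarrow> 'r)"
  by unfold_locales (auto simp: algebra_simps)

lemma is_ideal_ideal_of: "is_ideal (ideal_of G)"
  unfolding is_ideal_def ideal_of_def
  by (auto intro: module.span_zero[OF module_times] module.span_add[OF module_times]
      module.span_scale[OF module_times])

lemma generator_in_ideal: "a \<in> G \<Longrightarrow> a \<in> ideal_of G"
  unfolding ideal_of_def by (rule module.span_base[OF module_times])

lemma ideal_of_induct [consumes 1, case_names zero step]:
  assumes "x \<in> ideal_of G" "P 0" "\<And>c a y. a \<in> G \<Longrightarrow> P y \<Longrightarrow> P (c * a + y)"
  shows "P x"
  using module.span_induct_alt[OF module_times, of x G P] assms by (auto simp: ideal_of_def)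

lemma ideal_of_subset: "is_ideal I \<Longrightarrow> G \<subseteq> I \<Longrightarrow> ideal_of G \<subseteq> I"
  by (rule subsetI, erule ideal_of_induct) (auto simp: is_ideal_def)

lemma ideal_of_singleton: "x \<in> ideal_of {a} \<Longrightarrow> \<exists>v. x = v * a"
proof (induction rule: ideal_of_induct)
  case zero
  show ?case by (intro exI[of _ 0]) simp
next
  case (step c b y)
  then show ?case by (metis distrib_right singletonD)
qed

lemma is_ideal_sum: "is_ideal I \<Longrightarrow> (\<And>x. x \<in> A \<Longrightarrow> a x \<in> I) \<Longrightarrow> sum a A \<in> I"
  by (induction A rule: infinite_finite_induct) (auto simp: is_ideal_def)

section \<open>Polynomial rings and their real points\<close>

lemma const_add: "const (c + d) = const c + const d"
  by (simp add: const_def single_add)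

lemma const_mult: "const (c * d :: 'a::comm_ring_1) = const c * const d"
  by (simp add: const_def mult_single)

lemma const_1 [simp]: "const 1 = 1" and const_0 [simp]: "const 0 = 0"
  by (simp_all add: const_def)

interpretation mpoly: archimedean_algebra "const :: 'a \<Rightarrow> ('n, 'a::archimedean_field) mpoly"
  by unfold_locales (auto simp: const_add const_mult)

lemma mpoly_sum_monomials:
  "p = (\<Sum>\<alpha>\<in>Poly_Mapping.keys p. Poly_Mapping.single \<alpha> (Poly_Mapping.lookup p \<alpha>))"
  by (rule poly_mapping_eqI)
     (auto simp: lookup_sum lookup_single when_def in_keys_iff)

lemma mpoly_induct [case_names monomial add]:
  fixes p :: "('n, 'a::comm_monoid_add) mpoly"
  assumes "\<And>\<alpha> c. P (Poly_Mapping.single \<alpha> c)" "\<And>p q. P p \<Longrightarrow> P q \<Longrightarrow> P (p + q)"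
  shows "P p"
proof -
  have "P (\<Sum>\<alpha>\<in>A. Poly_Mapping.single \<alpha> (Poly_Mapping.lookup p \<alpha>))" for A
    using assms(1)[of 0 0] by (induction A rule: infinite_finite_induct) (auto intro: assms)
  then show ?thesis using mpoly_sum_monomials[of p] by metis
qed

abbreviation var :: "'n \<Rightarrow> ('n, 'a::comm_ring_1) mpoly" where
  "var i \<equiv> Poly_Mapping.single (Poly_Mapping.single i 1) 1"

text \<open>
  This makes a homomorphism on polynomials determined by its values on constants and variables.
\<close>

lemma monomial_eq_prod_var:
  fixes \<alpha> :: "('n::finite) monom"
  shows "Poly_Mapping.single \<alpha> (c::'a::comm_ring_1)
    = const c * (\<Prod>i\<in>UNIV. var i ^ Poly_Mapping.lookup \<alpha> i)"
proof -
  have pow: "var i ^ k = Poly_Mapping.single (Poly_Mapping.single i k) (1::'a)" for i :: 'n and k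
    by (induction k) (auto simp: mult_single single_add[symmetric] simp flip: single_one)
  have prod: "(\<Prod>i\<in>A. Poly_Mapping.single (\<beta> i) (1::'a)) = Poly_Mapping.single (\<Sum>i\<in>A. \<beta> i) 1"
    for A and \<beta> :: "'n \<Rightarrow> 'n monom"
    by (induction A rule: infinite_finite_induct) (auto simp: mult_single)
  have "(\<Sum>i\<in>UNIV. Poly_Mapping.single i (Poly_Mapping.lookup \<alpha> i)) = \<alpha>"
    by (rule poly_mapping_eqI) (simp add: lookup_sum lookup_single when_def)
  then show ?thesis unfolding pow prod by (simp add: const_def mult_single)
qed

lemma real_point_sum: "real_point \<phi> \<Longrightarrow> \<phi> (sum a A) = (\<Sum>x\<in>A. \<phi> (a x))"
  by (induction A rule: infinite_finite_induct) (auto simp: real_pointD)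

lemma real_point_power: "real_point \<phi> \<Longrightarrow> \<phi> (a ^ k) = \<phi> a ^ k"
  by (induction k) (auto simp: real_pointD)

lemma real_point_prod: "real_point \<phi> \<Longrightarrow> \<phi> (prod a A) = (\<Prod>x\<in>A. \<phi> (a x))"
  by (induction A rule: infinite_finite_induct) (auto simp: real_pointD)

lemma real_point_expand:
  fixes p :: "('n::finite, 'a::comm_ring_1) mpoly"
  assumes "real_point \<phi>"
  shows "\<phi> p = (\<Sum>\<alpha>\<in>Poly_Mapping.keys p. \<phi> (const (Poly_Mapping.lookup p \<alpha>))
     * (\<Prod>i\<in>UNIV. \<phi> (var i) ^ Poly_Mapping.lookup \<alpha> i))"
  by (subst mpoly_sum_monomials, subst monomial_eq_prod_var)
     (simp add: real_point_sum[OF assms] real_point_prod[OF assms] real_point_power[OF assms]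
        real_pointD(2)[OF assms])

lemma real_point_of_int:
  assumes "real_point \<phi>"
  shows "\<phi> (of_int z) = of_int z"
proof -
  note J = real_pointD[OF assms]
  have nat: "\<phi> (of_nat n) = of_nat n" for n by (induction n) (auto simp: J)
  show ?thesis by (cases z rule: int_diff_cases) (simp add: J nat)
qed

lemma real_point_rat:
  assumes "real_point (j :: rat \<Rightarrow> real)"
  shows "j r = of_rat r"
proof (cases r)
  case (Fract a b)
  then have "r * of_int b = of_int a" by (simp add: Fract_of_int_quotient)
  then have "j r * of_int b = of_int a"
    using real_pointD(2)[OF assms, of r "of_int b"] by (simp add: real_point_of_int[OF assms])
  then show ?thesis using Fract by (simp add: of_rat_rat field_simps)
qed

text \<open>
  A ring endomorphism of the reals preserves squares, hence the order, and it fixes the rationals;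
  by density it is the identity.
\<close>

lemma real_point_real:
  assumes "real_point (j :: real \<Rightarrow> real)"
  shows "j x = x"
proof -
  note J = real_pointD[OF assms]
  have "real_point (\<lambda>r. j (of_rat r))" by (simp add: real_point_def of_rat_add of_rat_mult J)
  then have rat: "j (of_rat r) = of_rat r" for r by (rule real_point_rat)
  have nonneg: "j y \<ge> 0" if "y \<ge> 0" for y
    using J(2)[of "sqrt y" "sqrt y"] that by simp
  have le: "j y \<le> j z" if "y \<le> z" for y z using nonneg[of "z - y"] that by (simp add: J)
  show ?thesis
  proof (rule ccontr)
    assume "j x \<noteq> x"
    then consider "j x < x" | "x < j x" by linarith
    then show False
    proof cases
      case 1
      then obtain r where "j x < real_of_rat r" "real_of_rat r < x" by (rule rat_in_open_interval)
      with le[of "of_rat r" x] show False by (simp add: rat)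
    next
      case 2
      then obtain r where "x < real_of_rat r" "real_of_rat r < j x" by (rule rat_in_open_interval)
      with le[of x "of_rat r"] show False by (simp add: rat)
    qed
  qed
qed

lemma real_point_const: "real_point \<phi> \<Longrightarrow> real_point (\<lambda>c. \<phi> (const c))"
  by (auto simp: real_point_def const_add const_mult)

lemma eval_superset:
  assumes "finite A" "Poly_Mapping.keys p \<subseteq> A"
  shows "eval \<xi> p = (\<Sum>\<alpha>\<in>A. Poly_Mapping.lookup p \<alpha> * (\<Prod>i\<in>UNIV. (\<xi> $ i) ^ Poly_Mapping.lookup \<alpha> i))"
  unfolding eval_def using assms by (intro sum.mono_neutral_left) (auto simp: in_keys_iff)

lemma eval_add: "eval \<xi> (p + q) = eval \<xi> p + eval \<xi> q"
proof -
  let ?A = "Poly_Mapping.keys p \<union> Poly_Mapping.keys q"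
  have "Poly_Mapping.keys (p + q) \<subseteq> ?A" by (rule keys_add)
  then show ?thesis
    by (simp add: eval_superset[of ?A] lookup_add sum.distrib algebra_simps)
qed

lemma eval_monomial:
  "eval \<xi> (Poly_Mapping.single \<alpha> c) = c * (\<Prod>i\<in>UNIV. (\<xi> $ i) ^ Poly_Mapping.lookup \<alpha> i)"
  by (simp add: eval_superset[of "{\<alpha>}"])

lemma eval_mult: "eval \<xi> (p * q) = eval \<xi> p * eval \<xi> q"
proof (induction p rule: mpoly_induct)
  case (monomial \<alpha> c)
  show ?case
    by (induction q rule: mpoly_induct)
       (simp_all add: mult_single eval_monomial lookup_add power_add prod.distrib eval_add algebra_simps)
qed (simp add: eval_add algebra_simps)

lemma eval_const: "eval \<xi> (const c) = c"
  by (simp add: const_def eval_monomial)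

lemma real_point_eval: "real_point (eval \<xi>)"
  using eval_const[of \<xi> 1] by (simp add: real_point_def eval_add eval_mult)

section \<open>Degrees\<close>

text \<open>
  In terms of supports no case distinction on the zero polynomial or on negative bounds is left.
\<close>

lemma polys_deg_le_iff: "p \<in> polys_deg_le k \<longleftrightarrow> (\<forall>\<alpha>\<in>Poly_Mapping.keys p. int (monom_deg \<alpha>) \<le> k)"
proof (cases "p = 0")
  case False
  then obtain \<beta> where \<beta>: "\<beta> \<in> Poly_Mapping.keys p"
    by (metis ex_in_conv keys_zero poly_mapping_eqI not_in_keys_iff_lookup_eq_zero lookup_zero)
  have le: "monom_deg \<alpha> \<le> deg p" if "\<alpha> \<in> Poly_Mapping.keys p" for \<alpha>
    unfolding deg_def using that by (intro Max_ge) auto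
  have "deg p \<in> insert 0 (monom_deg ` Poly_Mapping.keys p)"
    unfolding deg_def by (intro Max_in) auto
  then obtain \<alpha> where "\<alpha> \<in> Poly_Mapping.keys p" "deg p = monom_deg \<alpha>"
    using le[OF \<beta>] \<beta> by force
  then show ?thesis using False le by (fastforce simp: polys_deg_le_def)
qed (simp add: polys_deg_le_def)

lemma deg_le_iff: "deg p \<le> d \<longleftrightarrow> p \<in> polys_deg_le (int d)"
  by (auto simp: polys_deg_le_def deg_def)

lemma polys_deg_le_mono: "p \<in> polys_deg_le k \<Longrightarrow> k \<le> k' \<Longrightarrow> p \<in> polys_deg_le k'"
  by (auto simp: polys_deg_le_def)

lemma polys_deg_le_add: "p \<in> polys_deg_le k \<Longrightarrow> q \<in> polys_deg_le k \<Longrightarrow> p + q \<in> polys_deg_le k"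
  using keys_add[of p q] by (auto simp: polys_deg_le_iff)

lemma polys_deg_le_sum: "(\<And>x. x \<in> A \<Longrightarrow> p x \<in> polys_deg_le k) \<Longrightarrow> sum p A \<in> polys_deg_le k"
proof (induction A rule: infinite_finite_induct)
  case (insert x A)
  then show ?case by (auto intro: polys_deg_le_add)
qed (auto simp: polys_deg_le_def)

lemma polys_deg_le_mult:
  fixes p q :: "('n::finite, 'a::comm_ring_1) mpoly"
  assumes "p \<in> polys_deg_le j" "q \<in> polys_deg_le k"
  shows "p * q \<in> polys_deg_le (j + k)"
  unfolding polys_deg_le_iff
proof
  fix \<gamma> assume "\<gamma> \<in> Poly_Mapping.keys (p * q)"
  then obtain \<alpha> \<beta> where "\<alpha> \<in> Poly_Mapping.keys p" "\<beta> \<in> Poly_Mapping.keys q" "\<gamma> = \<alpha> + \<beta>"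
    using keys_mult[of p q] by blast
  then show "int (monom_deg \<gamma>) \<le> j + k"
    using assms by (auto simp: polys_deg_le_iff monom_deg_def lookup_add sum.distrib intro: add_mono)
qed

lemma const_in_polys_deg_le: "const c \<in> polys_deg_le 0"
  by (auto simp: polys_deg_le_iff const_def monom_deg_def)

lemma polys_deg_le_const_mult:
  fixes p :: "('n::finite, 'a::comm_ring_1) mpoly"
  shows "p \<in> polys_deg_le k \<Longrightarrow> const c * p \<in> polys_deg_le k"
  using polys_deg_le_mult[OF const_in_polys_deg_le] by fastforce

lemma polys_deg_le_square:
  fixes p :: "('n::finite, 'a::comm_ring_1) mpoly"
  shows "p \<in> polys_deg_le k \<Longrightarrow> p\<^sup>2 \<in> polys_deg_le (2 * k)"
  using polys_deg_le_mult[of p k p k] by (simp add: power2_eq_square)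

lemma mpoly_eq_sum_const_monomials:
  fixes p :: "('n, 'a::comm_ring_1) mpoly"
  assumes "finite A" "Poly_Mapping.keys p \<subseteq> A"
  shows "p = (\<Sum>\<alpha>\<in>A. const (Poly_Mapping.lookup p \<alpha>) * Poly_Mapping.single \<alpha> 1)"
proof -
  have "p = (\<Sum>\<alpha>\<in>A. Poly_Mapping.single \<alpha> (Poly_Mapping.lookup p \<alpha>))"
    by (subst mpoly_sum_monomials[of p], rule sum.mono_neutral_left) (use assms in \<open>auto simp: in_keys_iff\<close>)
  then show ?thesis by (simp add: const_def mult_single)
qed

section \<open>Certificates with degree bounds over one field\<close>

text \<open>
  Control of degrees. A representation of \<open>F\<close> modulo \<open>I\<close> stays valid modulo \<open>I\<close> when every
  polynomial \<open>q\<close> under a square is replaced by its normal form with support in \<open>B\<close>, which has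
  degree at most \<open>D\<close>. After this replacement the remainder in \<open>I\<close> has degree at most \<open>d\<close>, and the
  graded basis expresses it without exceeding that degree.
\<close>

theorem sos_certificate:
  fixes g h :: "nat \<Rightarrow> ('n::finite, 'a::archimedean_field) mpoly"
    and F u v :: "('n, 'a) mpoly"
  assumes graded: "graded_basis s h I"
    and span: "\<And>p. \<exists>r. Poly_Mapping.keys r \<subseteq> B \<and> p - r \<in> I"
    and B: "finite B" "\<And>b. b \<in> B \<Longrightarrow> monom_deg b \<le> D"
    and g0: "g 0 = 1" and degF: "deg F \<le> d" and degg: "\<And>i. i \<le> m \<Longrightarrow> 2 * D + deg (g i) \<le> d"
    and comax: "u + v * F = 1" "F * u \<in> I"
    and nonneg: "\<forall>\<phi>. real_point \<phi> \<and> (\<forall>j\<in>{1..s}. \<phi> (h j) = 0) \<and> (\<forall>i\<le>m. \<phi> (g i) \<ge> 0) \<longrightarrow> \<phi> F \<ge> 0"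
  shows "\<exists>(N :: nat \<Rightarrow> nat) \<omega> q p.
    F = (\<Sum>i\<le>m. (\<Sum>k<N i. const (\<omega> i k) * (q i k)\<^sup>2) * g i) + (\<Sum>j=1..s. p j * h j) \<and>
    (\<forall>i\<le>m. \<forall>k<N i. \<omega> i k \<ge> 0 \<and> q i k \<in> polys_deg_le (int D)) \<and>
    (\<forall>j\<in>{1..s}. p j \<in> polys_deg_le (int d - int (deg (h j))))"
proof -
  have I: "I = ideal_of (h ` {1..s})" using graded by (simp add: graded_basis_def)
  have id: "is_ideal I" unfolding I by (rule is_ideal_ideal_of)
  define B' where "B' = (\<lambda>\<alpha>. Poly_Mapping.single \<alpha> (1::'a)) ` B"
  have inj: "inj_on (\<lambda>\<alpha>. Poly_Mapping.single \<alpha> (1::'a)) B"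
    by (rule inj_onI) (metis keys_single one_neq_zero singleton_inject)
  have "mpoly.spans_mod B' I"
    unfolding mpoly.spans_mod_def
  proof
    fix a :: "('n, 'a) mpoly"
    obtain r where r: "Poly_Mapping.keys r \<subseteq> B" "a - r \<in> I" using span by blast
    define c where "c b = Poly_Mapping.lookup r (the_inv_into B (\<lambda>\<alpha>. Poly_Mapping.single \<alpha> (1::'a)) b)" for b
    have "(\<Sum>b\<in>B'. const (c b) * b) = (\<Sum>\<alpha>\<in>B. const (Poly_Mapping.lookup r \<alpha>) * Poly_Mapping.single \<alpha> 1)"
      unfolding B'_def c_def by (simp add: sum.reindex[OF inj] the_inv_into_f_f[OF inj])
    also have "\<dots> = r"
      by (rule mpoly_eq_sum_const_monomials[OF B(1) r(1), symmetric])
    finally have "(\<Sum>b\<in>B'. const (c b) * b) = r" .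
    then show "\<exists>c. a - (\<Sum>b\<in>B'. const (c b) * b) \<in> I" using r(2) by (intro exI[of _ c]) simp
  qed
  moreover have "finite B'" using B(1) by (simp add: B'_def)
  ultimately have "F \<in> mpoly.generated_qmod m g I"
  proof (intro mpoly.nonnegative_in_generated_qmod[of I B' g u v F m, OF id _ _ g0 comax])
    fix \<phi> :: "('n, 'a) mpoly \<Rightarrow> real"
    assume \<phi>: "real_point \<phi>" "\<And>p. p \<in> I \<Longrightarrow> \<phi> p = 0" "\<And>i. i \<le> m \<Longrightarrow> \<phi> (g i) \<ge> 0"
    have "\<phi> (h j) = 0" if "j \<in> {1..s}" for j
      by (rule \<phi>(2), unfold I, intro generator_in_ideal imageI that)
    then show "\<phi> F \<ge> 0" using nonneg \<phi>(1,3) by blast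
  qed
  then obtain \<sigma> j where \<sigma>: "\<And>i. i \<le> m \<Longrightarrow> \<sigma> i \<in> mpoly.wsos" "j \<in> I" "F = (\<Sum>i\<le>m. \<sigma> i * g i) + j"
    by (auto simp: mpoly.generated_qmod_def)
  define good where "good i t \<longleftrightarrow> (case t of (N, \<omega>, q) \<Rightarrow>
    \<sigma> i = (\<Sum>k<N. const (\<omega> k) * (q k)\<^sup>2) \<and> (\<forall>k<(N::nat). \<omega> k \<ge> 0))" for i t
  have "\<exists>t. good i t" if "i \<le> m" for i
    by (rule mpoly.wsos_explicit[OF \<sigma>(1)[OF that]]) (auto simp: good_def)
  then obtain t where t: "\<And>i. i \<le> m \<Longrightarrow> good i (t i)" by metis
  define N \<omega> q where "N i = fst (t i)" and "\<omega> i = fst (snd (t i))" and "q i = snd (snd (t i))" for i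
  have q: "\<sigma> i = (\<Sum>k<N i. const (\<omega> i k) * (q i k)\<^sup>2)" "k < N i \<Longrightarrow> \<omega> i k \<ge> 0"
    if "i \<le> m" for i k
    using t[OF that] by (auto simp: good_def N_def \<omega>_def q_def split: prod.splits)
  obtain red where red: "\<And>p. Poly_Mapping.keys (red p) \<subseteq> B" "\<And>p. p - red p \<in> I"
    using span by metis
  define r where "r i k = red (q i k)" for i k
  have degr: "r i k \<in> polys_deg_le (int D)" for i k
    using red(1)[of "q i k"] B(2) by (auto simp: r_def polys_deg_le_iff)
  define \<tau> where "\<tau> i = (\<Sum>k<N i. const (\<omega> i k) * (r i k)\<^sup>2)" for i
  define R where "R = F - (\<Sum>i\<le>m. \<tau> i * g i)"
  have "\<sigma> i * g i - \<tau> i * g i \<in> I" if "i \<le> m" for i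
  proof -
    have "g i * (const (\<omega> i k) * (q i k + r i k)) * (q i k - r i k) \<in> I" for k
      using red(2)[of "q i k"] id by (auto simp: r_def is_ideal_def)
    then have "(\<Sum>k<N i. g i * (const (\<omega> i k) * (q i k + r i k)) * (q i k - r i k)) \<in> I"
      by (intro is_ideal_sum[OF id])
    moreover have "(\<Sum>k<N i. g i * (const (\<omega> i k) * (q i k + r i k)) * (q i k - r i k))
      = \<sigma> i * g i - \<tau> i * g i"
      by (simp add: q(1)[OF that] \<tau>_def sum_distrib_left sum_subtractf
          power2_eq_square algebra_simps)
    ultimately show ?thesis by simp
  qed
  then have "(\<Sum>i\<le>m. \<sigma> i * g i - \<tau> i * g i) + j \<in> I"
    using is_ideal_sum[OF id, of "{..m}"] \<sigma>(2) id by (auto simp: is_ideal_def)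
  then have R: "R \<in> I" by (simp add: R_def \<sigma>(3) sum_subtractf algebra_simps)
  have "\<tau> i * g i \<in> polys_deg_le (int d)" if "i \<le> m" for i
  proof -
    have "\<tau> i \<in> polys_deg_le (2 * int D)"
      unfolding \<tau>_def by (intro polys_deg_le_sum polys_deg_le_const_mult polys_deg_le_square degr)
    moreover have "g i \<in> polys_deg_le (int (deg (g i)))" by (simp add: polys_deg_le_def)
    ultimately have "\<tau> i * g i \<in> polys_deg_le (2 * int D + int (deg (g i)))"
      by (rule polys_deg_le_mult)
    then show ?thesis by (rule polys_deg_le_mono) (use degg[OF that] in linarith)
  qed
  then have "(\<Sum>i\<le>m. \<tau> i * g i) \<in> polys_deg_le (int d)" by (intro polys_deg_le_sum) auto
  moreover have "F \<in> polys_deg_le (int d)" using degF by (simp add: deg_le_iff)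
  ultimately have "F + const (- 1) * (\<Sum>i\<le>m. \<tau> i * g i) \<in> polys_deg_le (int d)"
    by (intro polys_deg_le_add polys_deg_le_const_mult)
  then have degR: "deg R \<le> d" by (simp add: R_def deg_le_iff mpoly.\<kappa>_minus)
  obtain p where p: "R = (\<Sum>j=1..s. p j * h j)"
    "\<And>j. j \<in> {1..s} \<Longrightarrow> p j \<in> polys_deg_le (int (deg R) - int (deg (h j)))"
    using graded R unfolding graded_basis_def by blast
  have "F = (\<Sum>i\<le>m. (\<Sum>k<N i. const (\<omega> i k) * (r i k)\<^sup>2) * g i) + (\<Sum>j=1..s. p j * h j)"
    unfolding p(1)[symmetric] R_def \<tau>_def by simp
  moreover have "\<forall>i\<le>m. \<forall>k<N i. \<omega> i k \<ge> 0 \<and> r i k \<in> polys_deg_le (int D)"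
    using q(2) degr by blast
  moreover have "p j \<in> polys_deg_le (int d - int (deg (h j)))" if "j \<in> {1..s}" for j
    using p(2)[OF that] by (rule polys_deg_le_mono) (use degR in simp)
  ultimately show ?thesis by blast
qed

section \<open>Change of coefficients\<close>

lemma lookup_map_coeffs:
  "f 0 = 0 \<Longrightarrow> Poly_Mapping.lookup (Poly_Mapping.map f p) \<alpha> = f (Poly_Mapping.lookup p \<alpha>)"
  by (simp add: Poly_Mapping.map.rep_eq when_def)

lemma map_coeffs_add:
  fixes f :: "'a::ab_group_add \<Rightarrow> 'b::ab_group_add"
  assumes "\<And>x y. f (x + y) = f x + f y"
  shows "Poly_Mapping.map f (p + q) = Poly_Mapping.map f p + Poly_Mapping.map f q"
proof -
  have "f 0 = 0" using assms[of 0 0] by simp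
  then show ?thesis by (intro poly_mapping_eqI) (simp add: lookup_map_coeffs lookup_add assms)
qed

text \<open>
  Coefficientwise maps that are semilinear over another ring of coefficients. With \<open>f = h\<close> a ring
  homomorphism this is multiplicativity; with \<open>f\<close> a \<open>\<rat>\<close>-linear functional on the reals, \<open>e\<close> the
  inclusion of the rationals and \<open>h\<close> the identity it is linearity over rational polynomials.
\<close>

lemma map_coeffs_mult:
  fixes f :: "'a::comm_ring_1 \<Rightarrow> 'c::comm_ring_1" and e :: "'b::comm_ring_1 \<Rightarrow> 'a" and h :: "'b \<Rightarrow> 'c"
  assumes add: "\<And>x y. f (x + y) = f x + f y" "\<And>x y. e (x + y) = e x + e y" "\<And>x y. h (x + y) = h x + h y"
    and semi: "\<And>x y. f (x * e y) = f x * h y"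
  shows "Poly_Mapping.map f (p * Poly_Mapping.map e q)
    = (Poly_Mapping.map f p * Poly_Mapping.map h q :: ('n, 'c) mpoly)"
proof -
  have 0: "f 0 = 0" "e 0 = 0" "h 0 = 0" using add(1)[of 0 0] add(2)[of 0 0] add(3)[of 0 0] by auto
  have single: "Poly_Mapping.map f (Poly_Mapping.single \<alpha> c) = Poly_Mapping.single \<alpha> (f c)"
    "Poly_Mapping.map e (Poly_Mapping.single \<alpha> d) = Poly_Mapping.single \<alpha> (e d)"
    "Poly_Mapping.map h (Poly_Mapping.single \<alpha> d) = Poly_Mapping.single \<alpha> (h d)" for \<alpha> :: "'n monom" and c d
    using 0 by (auto simp: when_def)
  note maps = map_coeffs_add[of f, OF add(1)] map_coeffs_add[of e, OF add(2)] map_coeffs_add[of h, OF add(3)]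
  show ?thesis
  proof (induction p rule: mpoly_induct)
    case (monomial \<alpha> c)
    show ?case
    proof (induction q rule: mpoly_induct)
      case (monomial \<beta> d)
      show ?case unfolding single mult_single semi ..
    next
      case (add q q')
      then show ?case by (simp only: maps distrib_left)
    qed
  next
    case (add p p')
    then show ?case by (simp only: maps distrib_right)
  qed
qed

lemma map_coeffs_id: "Poly_Mapping.map (\<lambda>x. x) p = p"
  by (rule poly_mapping_eqI) (simp add: lookup_map_coeffs)

lemma lookup_extend [simp]: "Poly_Mapping.lookup (extend p) \<alpha> = of_rat (Poly_Mapping.lookup p \<alpha>)"
  by (simp add: extend_def lookup_map_coeffs)

lemma keys_extend [simp]: "Poly_Mapping.keys (extend p) = Poly_Mapping.keys p"
  by (auto simp: in_keys_iff)

lemma deg_extend [simp]: "deg (extend p) = deg p"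
  by (simp add: deg_def)

lemma extend_add: "extend (p + q) = extend p + extend q"
  by (rule poly_mapping_eqI) (simp add: lookup_add of_rat_add)

lemma extend_mult: "extend (p * q) = extend p * extend q"
  using map_coeffs_mult[of of_rat "\<lambda>x. x" of_rat p q]
  by (simp add: extend_def of_rat_add of_rat_mult map_coeffs_id)

lemma extend_const: "extend (const c) = const (of_rat c)"
  by (rule poly_mapping_eqI) (simp add: const_def lookup_single when_def)

lemma extend_0 [simp]: "extend 0 = 0" and extend_1 [simp]: "extend 1 = 1"
  using extend_const[of 0] extend_const[of 1] by auto

lemma extend_diff: "extend (p - q) = extend p - extend q"
  by (rule poly_mapping_eqI) (simp add: lookup_minus of_rat_diff)

lemma extend_sum: "extend (sum p A) = (\<Sum>x\<in>A. extend (p x))"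
  by (induction A rule: infinite_finite_induct) (auto simp: extend_add)

lemma extend_power2: "extend (p\<^sup>2) = (extend p)\<^sup>2"
  by (simp add: power2_eq_square extend_mult)

lemma extend_in_polys_deg_le [simp]: "extend p \<in> polys_deg_le k \<longleftrightarrow> p \<in> polys_deg_le k"
  by (simp add: polys_deg_le_iff)

lemma real_point_is_evaluation:
  fixes \<phi> :: "('n::finite, real) mpoly \<Rightarrow> real"
  assumes "real_point \<phi>"
  shows "\<phi> p = eval (\<chi> i. \<phi> (var i)) p"
  by (subst real_point_expand[OF assms])
     (simp add: eval_def real_point_real[OF real_point_const[OF assms]])

lemma real_point_is_evaluation_rat:
  fixes \<phi> :: "('n::finite, rat) mpoly \<Rightarrow> real"
  assumes "real_point \<phi>"
  shows "\<phi> p = eval (\<chi> i. \<phi> (var i)) (extend p)"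
  by (subst real_point_expand[OF assms])
     (simp add: eval_def real_point_rat[OF real_point_const[OF assms]])

section \<open>Ideals over the rationals and over the reals\<close>

text \<open>
  Coordinates of the reals with respect to a basis over the rationals that contains 1; \<open>coord b x\<close>
  is the coefficient of \<open>b\<close> in \<open>x\<close>, and it is 0 when \<open>b\<close> is not in the basis.
\<close>

definition rational_coordinates :: "(real \<Rightarrow> real \<Rightarrow> rat) \<Rightarrow> bool" where
  "rational_coordinates coord \<longleftrightarrow>
     (\<forall>b x y. coord b (x + y) = coord b x + coord b y) \<and>
     (\<forall>b x r. coord b (x * of_rat r) = coord b x * r) \<and>
     (\<forall>x. finite {b. coord b x \<noteq> 0}) \<and>
     (\<forall>x. x = (\<Sum>b | coord b x \<noteq> 0. b * of_rat (coord b x))) \<and>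
     coord 1 1 = 1"

lemma rational_coordinates_exist: "\<exists>coord. rational_coordinates coord"
proof -
  interpret Q: vector_space "\<lambda>(r::rat) (x::real). of_rat r * x"
    by unfold_locales (auto simp: algebra_simps of_rat_add of_rat_mult)
  define \<B> where "\<B> = Q.extend_basis {1::real}"
  have ind1: "Q.independent {1::real}" by simp
  have ind: "Q.independent \<B>" and span: "Q.span \<B> = UNIV" and one: "1 \<in> \<B>"
    using Q.independent_extend_basis[OF ind1] Q.span_extend_basis[OF ind1]
      Q.extend_basis_superset[OF ind1] by (auto simp: \<B>_def)
  show ?thesis
    unfolding rational_coordinates_def
  proof (intro exI[of _ "\<lambda>b x. Q.representation \<B> x b"] conjI allI)
    show "Q.representation \<B> (x + y) b = Q.representation \<B> x b + Q.representation \<B> y b" for x y b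
      by (subst Q.representation_add[OF ind]) (auto simp: span)
    show "Q.representation \<B> (x * of_rat r) b = Q.representation \<B> x b * r" for x r b
      by (subst mult.commute, subst Q.representation_scale[OF ind]) (auto simp: span)
    show "finite {b. Q.representation \<B> x b \<noteq> 0}" for x
      by (rule Q.finite_representation)
    show "x = (\<Sum>b | Q.representation \<B> x b \<noteq> 0. b * of_rat (Q.representation \<B> x b))" for x
    proof -
      have "x \<in> Q.span \<B>" by (simp add: span)
      then show ?thesis using Q.sum_nonzero_representation_eq[OF ind] by (simp add: mult.commute)
    qed
    show "Q.representation \<B> 1 1 = 1"
      using Q.representation_basis[OF ind one] by simp
  qed
qed

text \<open>
  Applied to all coefficients, a \<open>\<rat>\<close>-linear functional is linear over rational polynomials, so it
  maps the extended ideal back into \<open>I\<close>.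
\<close>

lemma coordinate_of_extended_ideal:
  assumes I: "is_ideal I"
    and \<phi>: "\<And>x y. \<phi> (x + y) = \<phi> x + \<phi> y" "\<And>x r. \<phi> (x * of_rat r) = \<phi> x * r"
    and p: "p \<in> ideal_of (extend ` I)"
  shows "Poly_Mapping.map (\<phi> :: real \<Rightarrow> rat) p \<in> I"
  using p
proof (induction rule: ideal_of_induct)
  case zero
  have "Poly_Mapping.map \<phi> (0 :: ('a, real) mpoly) = 0" by (rule poly_mapping_eqI) (simp add: Poly_Mapping.map.rep_eq)
  then show ?case using I by (simp add: is_ideal_def)
next
  case (step c a y)
  then obtain a' where a': "a' \<in> I" "a = extend a'" by auto
  have "Poly_Mapping.map \<phi> (c * extend a') = Poly_Mapping.map \<phi> c * a'"
    using map_coeffs_mult[of \<phi> of_rat "\<lambda>x. x" c a'] \<phi> by (simp add: extend_def of_rat_add map_coeffs_id)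
  then have "Poly_Mapping.map \<phi> (c * a + y) = Poly_Mapping.map \<phi> c * a' + Poly_Mapping.map \<phi> y"
    by (simp add: map_coeffs_add[of \<phi>, OF \<phi>(1)] a'(2))
  then show ?case using I a'(1) step(2) by (simp add: is_ideal_def)
qed

text \<open>
  The coordinate of 1 maps a real solution of \<open>u + v F = 1\<close> to a rational one.
\<close>

lemma comaximality_descends:
  fixes u v :: "('n, real) mpoly"
  assumes I: "is_ideal I" and uv: "u + v * extend F = 1" "extend F * u \<in> ideal_of (extend ` I)"
  obtains u' v' where "u' + v' * F = 1" "F * u' \<in> I"
proof -
  obtain coord where "rational_coordinates coord"
    using rational_coordinates_exist by blast
  then have coord: "\<And>b x y. coord b (x + y) = coord b x + coord b y"
      "\<And>b x r. coord b (x * of_rat r) = coord b x * r"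
      "\<And>x. finite {b. coord b x \<noteq> 0}"
      "\<And>x. x = (\<Sum>b | coord b x \<noteq> 0. b * of_rat (coord b x))"
      "coord 1 1 = 1"
    unfolding rational_coordinates_def by blast+
  let ?T = "Poly_Mapping.map (coord 1)"
  have zero: "coord 1 0 = 0" using coord(1)[of 1 0 0] by simp
  have semi: "?T (a * extend b) = ?T a * b" for a :: "('n, real) mpoly" and b
    using map_coeffs_mult[of "coord 1" of_rat "\<lambda>x. x" a b] coord(1,2)
    by (simp add: extend_def of_rat_add map_coeffs_id)
  have "?T (u + v * extend F) = ?T u + ?T v * F"
    by (simp add: map_coeffs_add[of "coord 1", OF coord(1)] semi)
  moreover have "?T (1 :: ('n, real) mpoly) = 1"
    by (rule poly_mapping_eqI) (simp add: lookup_map_coeffs zero lookup_one when_def coord(5))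
  ultimately have "?T u + ?T v * F = 1" using uv(1) by simp
  moreover have "F * ?T u \<in> I"
    using coordinate_of_extended_ideal[of I "coord 1", OF I coord(1,2) uv(2)] semi[of u F]
    by (simp add: mult.commute)
  ultimately show ?thesis by (rule that)
qed

text \<open>
  All rational coordinates together: an element of the extended ideal is a real combination of
  elements of \<open>I\<close> whose supports are not larger. The latter carries degree bounds over from the
  rationals to the reals.
\<close>

lemma extended_ideal_decomposition:
  fixes p :: "('n, real) mpoly"
  assumes I: "is_ideal I" and p: "p \<in> ideal_of (extend ` I)"
  shows "\<exists>T c. finite T \<and> p = (\<Sum>b\<in>T. const b * extend (c b))
    \<and> (\<forall>b. c b \<in> I \<and> Poly_Mapping.keys (c b) \<subseteq> Poly_Mapping.keys p)"
proof -
  obtain coord where "rational_coordinates coord"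
    using rational_coordinates_exist by blast
  then have coord: "\<And>b x y. coord b (x + y) = coord b x + coord b y"
      "\<And>b x r. coord b (x * of_rat r) = coord b x * r"
      "\<And>x. finite {b. coord b x \<noteq> 0}"
      "\<And>x. x = (\<Sum>b | coord b x \<noteq> 0. b * of_rat (coord b x))"
      "coord 1 1 = 1"
    unfolding rational_coordinates_def by blast+
  have zero: "coord b 0 = 0" for b using coord(1)[of b 0 0] by simp
  define T where "T = (\<Union>\<alpha>\<in>Poly_Mapping.keys p. {b. coord b (Poly_Mapping.lookup p \<alpha>) \<noteq> 0})"
  define c where "c b = Poly_Mapping.map (coord b) p" for b
  have T: "finite T" using coord(3) by (auto simp: T_def)
  have lookup_c: "Poly_Mapping.lookup (c b) \<alpha> = coord b (Poly_Mapping.lookup p \<alpha>)" for b \<alpha>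
    by (simp add: c_def lookup_map_coeffs zero)
  have "p = (\<Sum>b\<in>T. const b * extend (c b))"
  proof (rule poly_mapping_eqI)
    fix \<alpha>
    have "Poly_Mapping.lookup (\<Sum>b\<in>T. const b * extend (c b)) \<alpha>
        = (\<Sum>b\<in>T. b * of_rat (coord b (Poly_Mapping.lookup p \<alpha>)))"
      by (simp add: lookup_sum const_def mult_map_scale_conv_mult[symmetric] lookup_map_coeffs lookup_c)
    also have "\<dots> = (\<Sum>b | coord b (Poly_Mapping.lookup p \<alpha>) \<noteq> 0. b * of_rat (coord b (Poly_Mapping.lookup p \<alpha>)))"
      by (rule sum.mono_neutral_right) (use T zero in \<open>force simp: T_def in_keys_iff\<close>)+
    also have "\<dots> = Poly_Mapping.lookup p \<alpha>" by (rule coord(4)[symmetric])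
    finally show "Poly_Mapping.lookup p \<alpha> = Poly_Mapping.lookup (\<Sum>b\<in>T. const b * extend (c b)) \<alpha>" ..
  qed
  moreover have "c b \<in> I" for b
    unfolding c_def by (rule coordinate_of_extended_ideal[OF I coord(1,2) p])
  moreover have "Poly_Mapping.keys (c b) \<subseteq> Poly_Mapping.keys p" for b
    by (auto simp: in_keys_iff lookup_c zero)
  ultimately show ?thesis using T by blast
qed

lemma graded_basis_extend:
  assumes graded: "graded_basis s h I"
  shows "graded_basis s (\<lambda>j. extend (h j) :: ('n::finite, real) mpoly) (ideal_of (extend ` I))"
  unfolding graded_basis_def
proof (intro conjI ballI)
  have I: "I = ideal_of (h ` {1..s})" using graded by (simp add: graded_basis_def)
  have idI: "is_ideal I" unfolding I by (rule is_ideal_ideal_of)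
  let ?R = "ideal_of ((\<lambda>j. extend (h j) :: ('n, real) mpoly) ` {1..s})"
  show "ideal_of (extend ` I) = ?R"
  proof
    have "extend a \<in> ?R" if "a \<in> I" for a
      using that unfolding I
    proof (induction rule: ideal_of_induct)
      case zero
      then show ?case using is_ideal_ideal_of by (auto simp: is_ideal_def)
    next
      case (step c b y)
      then have "extend b \<in> ?R" by (auto intro: generator_in_ideal)
      then show ?case using step(2) is_ideal_ideal_of[of "(\<lambda>j. extend (h j) :: ('n, real) mpoly) ` {1..s}"]
        by (simp add: is_ideal_def extend_add extend_mult)
    qed
    then show "ideal_of (extend ` I) \<subseteq> ?R" by (intro ideal_of_subset is_ideal_ideal_of) auto
    have "h j \<in> I" if "j \<in> {1..s}" for j
      unfolding I using that by (intro generator_in_ideal imageI)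
    then show "?R \<subseteq> ideal_of (extend ` I)"
      by (intro ideal_of_subset is_ideal_ideal_of) (auto intro!: generator_in_ideal)
  qed
  fix p :: "('n, real) mpoly" assume pI: "p \<in> ideal_of (extend ` I)"
  obtain T and a :: "real \<Rightarrow> ('n, rat) mpoly" where
    a: "finite T" "p = (\<Sum>b\<in>T. const b * extend (a b))"
      "\<And>b. a b \<in> I" "\<And>b. Poly_Mapping.keys (a b) \<subseteq> Poly_Mapping.keys p"
    using extended_ideal_decomposition[OF idI pI] by blast
  have deg_a: "deg (a b) \<le> deg p" for b
    using a(4)[of b] by (auto simp: deg_def intro!: Max_mono)
  have "\<forall>b. \<exists>c. a b = (\<Sum>j=1..s. c j * h j) \<and> (\<forall>j\<in>{1..s}. c j \<in> polys_deg_le (int (deg (a b)) - int (deg (h j))))"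
    using graded a(3) by (auto simp: graded_basis_def)
  from choice[OF this] obtain c where c: "\<And>b. a b = (\<Sum>j=1..s. c b j * h j)"
    "\<And>b j. j \<in> {1..s} \<Longrightarrow> c b j \<in> polys_deg_le (int (deg (a b)) - int (deg (h j)))"
    by blast
  define C where "C j = (\<Sum>b\<in>T. const b * extend (c b j) :: ('n, real) mpoly)" for j
  have "p = (\<Sum>b\<in>T. \<Sum>j=1..s. const b * extend (c b j) * extend (h j))"
    unfolding a(2) by (subst c(1)) (simp add: extend_sum extend_mult sum_distrib_left mult.assoc)
  also have "\<dots> = (\<Sum>j=1..s. C j * extend (h j))"
    unfolding C_def by (subst sum.swap) (simp add: sum_distrib_right)
  finally have p: "p = (\<Sum>j=1..s. C j * extend (h j))" .
  have "C j \<in> polys_deg_le (int (deg p) - int (deg (extend (h j) :: ('n, real) mpoly)))" if "j \<in> {1..s}" for j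
  proof -
    have "c b j \<in> polys_deg_le (int (deg p) - int (deg (h j)))" for b
      by (rule polys_deg_le_mono[OF c(2)[OF that]]) (use deg_a[of b] in simp)
    then show ?thesis
      unfolding C_def by (intro polys_deg_le_sum polys_deg_le_const_mult) simp
  qed
  with p show "\<exists>c. p = (\<Sum>j=1..s. c j * extend (h j)) \<and>
      (\<forall>j\<in>{1..s}. c j \<in> polys_deg_le (int (deg p) - int (deg (extend (h j) :: ('n, real) mpoly))))"
    by blast
qed

lemma spanning_monomials_extend:
  fixes p :: "('n, real) mpoly"
  assumes span: "\<And>p :: ('n, rat) mpoly. \<exists>r. Poly_Mapping.keys r \<subseteq> B \<and> p - r \<in> I"
  shows "\<exists>r. Poly_Mapping.keys r \<subseteq> B \<and> p - r \<in> ideal_of (extend ` I)"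
proof (induction p rule: mpoly_induct)
  case (monomial \<alpha> c)
  obtain r where r: "Poly_Mapping.keys r \<subseteq> B" "Poly_Mapping.single \<alpha> 1 - r \<in> I" using span by blast
  have single: "extend (Poly_Mapping.single \<alpha> 1) = (Poly_Mapping.single \<alpha> 1 :: ('n, real) mpoly)"
    by (rule poly_mapping_eqI) (simp add: lookup_single when_def)
  have "const c * extend (Poly_Mapping.single \<alpha> 1 - r) \<in> ideal_of (extend ` I)"
    using is_ideal_ideal_of[of "extend ` I :: ('n, real) mpoly set"] generator_in_ideal[OF imageI[OF r(2), of extend]]
    unfolding is_ideal_def by blast
  moreover have "const c * extend (Poly_Mapping.single \<alpha> 1 - r) = Poly_Mapping.single \<alpha> c - const c * extend r"
    by (simp add: extend_diff single right_diff_distrib const_def mult_single)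
  moreover have "Poly_Mapping.keys (const c * extend r) \<subseteq> B"
    using keys_mult[of "const c" "extend r :: ('n, real) mpoly"] r(1) by (auto simp: const_def split: if_splits)
  ultimately show ?case by (intro exI[of _ "const c * extend r"] conjI) simp_all
next
  case (add p q)
  then obtain r r' where r: "Poly_Mapping.keys r \<subseteq> B" "p - r \<in> ideal_of (extend ` I)"
    "Poly_Mapping.keys r' \<subseteq> B" "q - r' \<in> ideal_of (extend ` I)" by blast
  have "(p - r) + (q - r') \<in> ideal_of (extend ` I)"
    using r is_ideal_ideal_of[of "extend ` I :: ('n, real) mpoly set"] unfolding is_ideal_def by blast
  moreover have "Poly_Mapping.keys (r + r') \<subseteq> B" using keys_add[of r r'] r by blast
  ultimately show ?case by (intro exI[of _ "r + r'"]) (simp add: algebra_simps)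
qed

section \<open>Nonnegativity on the feasible set and the sum-of-squares bound\<close>

lemma finite_monom_deg_le: "finite {\<alpha> :: ('n::finite) monom. monom_deg \<alpha> \<le> D}"
proof (rule inj_on_finite)
  show "inj_on Poly_Mapping.lookup {\<alpha> :: 'n monom. monom_deg \<alpha> \<le> D}"
    by (rule inj_onI, rule poly_mapping_eqI) simp
  have "Poly_Mapping.lookup \<alpha> i \<le> monom_deg \<alpha>" for \<alpha> :: "'n monom" and i
    unfolding monom_deg_def by (rule member_le_sum) auto
  then have "Poly_Mapping.lookup \<alpha> i \<le> D" if "monom_deg \<alpha> \<le> D" for \<alpha> :: "'n monom" and i
    using that order_trans by blast
  then show "Poly_Mapping.lookup ` {\<alpha> :: 'n monom. monom_deg \<alpha> \<le> D}
      \<subseteq> {\<alpha>. \<forall>i. (i \<in> UNIV \<longrightarrow> \<alpha> i \<in> {..D}) \<and> (i \<notin> UNIV \<longrightarrow> \<alpha> i = 0)}"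
    by auto
  show "finite {\<alpha> :: 'n \<Rightarrow> nat. \<forall>i. (i \<in> UNIV \<longrightarrow> \<alpha> i \<in> {..D}) \<and> (i \<notin> UNIV \<longrightarrow> \<alpha> i = 0)}"
    by (rule finite_set_of_finite_funs) auto
qed

lemma eval_extend_complex:
  "eval (\<chi> i. complex_of_real (\<xi> $ i)) (extend p) = complex_of_real (eval \<xi> (extend p))"
proof -
  have "complex_of_rat r = complex_of_real (real_of_rat r)" for r
    by (cases r) (simp add: of_rat_rat)
  then show ?thesis unfolding eval_def by simp
qed

text \<open>
  Real zeros are complex zeros, and the latter are finite in number.
\<close>

lemma finite_feasible:
  assumes "zero_dimensional (ideal_of (h ` {1..s}))"
  shows "finite (feasible m g s h)"
proof (rule inj_on_finite)
  let ?\<iota> = "\<lambda>\<xi> :: real ^ 'a. \<chi> i. complex_of_real (\<xi> $ i)"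
  show "inj_on ?\<iota> (feasible m g s h)"
    by (auto simp: inj_on_def vec_eq_iff)
  show "finite {\<xi> :: complex ^ 'a. \<forall>p\<in>ideal_of (h ` {1..s}). eval \<xi> (extend p) = 0}"
    using assms by (simp add: zero_dimensional_def)
  have "eval \<xi> (extend p) = 0" if "p \<in> ideal_of (h ` {1..s})" "\<xi> \<in> feasible m g s h" for p \<xi>
    using that(1)
  proof (induction rule: ideal_of_induct)
    case zero
    then show ?case by (simp add: eval_def)
  next
    case (step c a y)
    then show ?case using that(2) by (auto simp: extend_add extend_mult eval_add eval_mult feasible_def)
  qed
  then show "?\<iota> ` feasible m g s h \<subseteq> {\<xi>. \<forall>p\<in>ideal_of (h ` {1..s}). eval \<xi> (extend p) = 0}"
    by (auto simp: eval_extend_complex)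
qed

lemma sos_nonneg: "\<sigma> \<in> sos k \<Longrightarrow> eval \<xi> \<sigma> \<ge> 0"
  by (auto simp: sos_def real_point_sum[OF real_point_eval] power2_eq_square eval_mult intro!: sum_nonneg)

text \<open>
  Over the reals weights are absorbed into the squares by taking square roots.
\<close>

lemma weighted_sum_in_sos:
  fixes q :: "nat \<Rightarrow> ('n::finite, real) mpoly"
  assumes "\<And>k. k < N \<Longrightarrow> \<omega> k \<ge> 0" "\<And>k. k < N \<Longrightarrow> q k \<in> polys_deg_le (d div 2)"
  shows "(\<Sum>k<N. const (\<omega> k) * (q k)\<^sup>2) \<in> sos d"
proof -
  have "const (\<omega> k) * (q k)\<^sup>2 = (const (sqrt (\<omega> k)) * q k)\<^sup>2" if "k < N" for k
    using assms(1)[OF that] by (simp add: power_mult_distrib power2_eq_square[of "const _"] const_mult[symmetric])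
  then have "(\<Sum>k<N. const (\<omega> k) * (q k)\<^sup>2) = (\<Sum>k<N. (const (sqrt (\<omega> k)) * q k)\<^sup>2)" by simp
  moreover have "\<forall>k<N. const (sqrt (\<omega> k)) * q k \<in> polys_deg_le (d div 2)"
    using assms(2) polys_deg_le_const_mult by blast
  ultimately show ?thesis unfolding sos_def mem_Collect_eq
    by (intro exI[of _ N] exI[of _ "\<lambda>k. const (sqrt (\<omega> k)) * q k"] conjI)
qed

lemma quadratic_moduleI:
  assumes "\<sigma> 0 \<in> sos d" "\<And>i. i \<in> {1..m} \<Longrightarrow> \<sigma> i \<in> sos (d - int (deg (g i)))"
    "\<And>j. j \<in> {1..s} \<Longrightarrow> c j \<in> polys_deg_le (d - int (deg (h j)))"
  shows "\<sigma> 0 + (\<Sum>i=1..m. g i * \<sigma> i) + (\<Sum>j=1..s. h j * c j) \<in> quadratic_module m g s h d"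
  unfolding quadratic_module_def set_sum_alt[OF finite_atLeastAtMost]
proof (intro set_plus_intro assms(1) CollectI exI conjI ballI)
  show "g i * \<sigma> i \<in> g i *o sos (d - int (deg (g i)))" if "i \<in> {1..m}" for i
    using assms(2)[OF that] by (rule set_times_intro2)
  show "h j * c j \<in> h j *o polys_deg_le (d - int (deg (h j)))" if "j \<in> {1..s}" for j
    using assms(3)[OF that] by (rule set_times_intro2)
qed (rule refl)+

lemma quadratic_module_nonneg:
  assumes p: "p \<in> quadratic_module m g s h d"
    and g: "\<And>i. i \<in> {1..m} \<Longrightarrow> eval \<xi> (g i) \<ge> 0" and h: "\<And>j. j \<in> {1..s} \<Longrightarrow> eval \<xi> (h j) = 0"
  shows "eval \<xi> p \<ge> 0"
proof -
  obtain \<sigma>0 a b where p: "p = \<sigma>0 + sum a {1..m} + sum b {1..s}" "\<sigma>0 \<in> sos d"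
    "\<forall>i\<in>{1..m}. a i \<in> g i *o sos (d - int (deg (g i)))"
    "\<forall>j\<in>{1..s}. b j \<in> h j *o polys_deg_le (d - int (deg (h j)))"
    using p unfolding quadratic_module_def set_sum_alt[OF finite_atLeastAtMost] set_plus_def by blast
  have "eval \<xi> (a i) \<ge> 0" if "i \<in> {1..m}" for i
    using p(3) g[OF that] that by (fastforce simp: elt_set_times_def eval_mult dest: sos_nonneg[of _ _ \<xi>])
  moreover have "eval \<xi> (b j) = 0" if "j \<in> {1..s}" for j
    using p(4) h[OF that] that by (fastforce simp: elt_set_times_def eval_mult)
  ultimately show ?thesis
    using sos_nonneg[OF p(2), of \<xi>]
    unfolding p(1) eval_add real_point_sum[OF real_point_eval]
    by (intro add_nonneg_nonneg sum_nonneg) auto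
qed

text \<open>
  The certificate is constructed over the field that contains \<open>fstar\<close>: over the rationals, after
  descent of the comaximality condition, if \<open>fstar\<close> is rational, and over the reals, after extension
  of the graded basis and of the monomial basis, otherwise.
\<close>

lemma graded_certificate_extend:
  fixes g h :: "nat \<Rightarrow> ('n::finite, rat) mpoly"
    and f :: "('n, rat) mpoly" and F :: "('n, real) mpoly" and fstar :: real
  assumes graded: "graded_basis s h I"
    and span: "\<And>p. \<exists>r. Poly_Mapping.keys r \<subseteq> B \<and> p - r \<in> I"
    and B: "finite B" "\<And>b. b \<in> B \<Longrightarrow> monom_deg b \<le> D"
    and g0: "g 0 = 1" and degf: "deg f \<le> d" and degg: "\<And>i. i \<le> m \<Longrightarrow> 2 * D + deg (g i) \<le> d"
    and F: "F = extend f - const fstar"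
    and comax: "u + v * F = 1" "F * u \<in> ideal_of (extend ` I)"
    and nonneg: "\<And>\<xi>. \<xi> \<in> feasible m g s h \<Longrightarrow> eval \<xi> F \<ge> 0"
  shows "\<exists>(N :: nat \<Rightarrow> nat) \<omega> q p.
    F = (\<Sum>i\<le>m. (\<Sum>k<N i. const (\<omega> i k) * (q i k)\<^sup>2) * extend (g i)) + (\<Sum>j=1..s. p j * extend (h j)) \<and>
    (\<forall>i\<le>m. \<forall>k<N i. \<omega> i k \<ge> 0 \<and> q i k \<in> polys_deg_le (int D)) \<and>
    (\<forall>j\<in>{1..s}. p j \<in> polys_deg_le (int d - int (deg (h j)))) \<and>
    (fstar \<in> \<rat> \<longrightarrow> (\<forall>i\<le>m. \<forall>k<N i. \<omega> i k \<in> \<rat> \<and> q i k \<in> range extend) \<and>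
      (\<forall>j\<in>{1..s}. p j \<in> range extend))"
proof (cases "fstar \<in> \<rat>")
  case True
  then obtain r where r: "fstar = of_rat r" by (auto elim: Rats_cases)
  define F' where "F' = f - const r"
  have F': "F = extend F'" by (simp add: F F'_def r extend_diff extend_const)
  have I: "is_ideal I" using graded by (simp add: graded_basis_def is_ideal_ideal_of)
  obtain u' v' where uv: "u' + v' * F' = 1" "F' * u' \<in> I"
    using comaximality_descends[of I u v F', OF I] comax unfolding F' by blast
  have "F' = f + const (- 1) * const r" by (simp add: F'_def mpoly.\<kappa>_minus)
  moreover have "const r \<in> polys_deg_le (int d)"
    by (rule polys_deg_le_mono[OF const_in_polys_deg_le]) simp
  ultimately have degF: "deg F' \<le> d"
    using degf by (auto simp: deg_le_iff intro: polys_deg_le_add polys_deg_le_const_mult)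
  have nonneg': "\<forall>\<phi>. real_point \<phi> \<and> (\<forall>j\<in>{1..s}. \<phi> (h j) = 0) \<and> (\<forall>i\<le>m. \<phi> (g i) \<ge> 0) \<longrightarrow> \<phi> F' \<ge> 0"
  proof (intro allI impI, elim conjE)
    fix \<phi> assume \<phi>: "real_point \<phi>" "\<forall>j\<in>{1..s}. \<phi> (h j) = 0" "\<forall>i\<le>m. \<phi> (g i) \<ge> 0"
    define \<xi> where "\<xi> = (\<chi> i. \<phi> (var i))"
    have ev: "\<phi> p = eval \<xi> (extend p)" for p
      unfolding \<xi>_def by (rule real_point_is_evaluation_rat[OF \<phi>(1)])
    have "\<xi> \<in> feasible m g s h"
      using \<phi>(2,3) by (simp add: feasible_def ev[symmetric])
    from nonneg[OF this] show "\<phi> F' \<ge> 0" by (simp add: F' ev[symmetric])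
  qed
  obtain N :: "nat \<Rightarrow> nat" and \<omega> q p where cert:
    "F' = (\<Sum>i\<le>m. (\<Sum>k<N i. const (\<omega> i k) * (q i k)\<^sup>2) * g i) + (\<Sum>j=1..s. p j * h j)"
    "\<forall>i\<le>m. \<forall>k<N i. \<omega> i k \<ge> 0 \<and> q i k \<in> polys_deg_le (int D)"
    "\<forall>j\<in>{1..s}. p j \<in> polys_deg_le (int d - int (deg (h j)))"
    using sos_certificate[of s h I B D g F' d m u' v', OF graded span B g0 degF degg uv nonneg'] by blast
  have "F = (\<Sum>i\<le>m. (\<Sum>k<N i. const (of_rat (\<omega> i k)) * (extend (q i k))\<^sup>2) * extend (g i))
      + (\<Sum>j=1..s. extend (p j) * extend (h j))"
    unfolding F' cert(1) by (simp add: extend_add extend_sum extend_mult extend_const extend_power2)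
  moreover have "\<forall>i\<le>m. \<forall>k<N i. real_of_rat (\<omega> i k) \<ge> 0
      \<and> (extend (q i k) :: ('n, real) mpoly) \<in> polys_deg_le (int D)"
    using cert(2) by simp
  moreover have "\<forall>j\<in>{1..s}. (extend (p j) :: ('n, real) mpoly) \<in> polys_deg_le (int d - int (deg (h j)))"
    using cert(3) by simp
  ultimately show ?thesis
    by (intro exI[of _ N] exI[of _ "\<lambda>i k. of_rat (\<omega> i k)"] exI[of _ "\<lambda>i k. extend (q i k)"]
        exI[of _ "\<lambda>j. extend (p j)"]) auto
next
  case False
  let ?g = "\<lambda>i. extend (g i) :: ('n, real) mpoly" and ?h = "\<lambda>j. extend (h j) :: ('n, real) mpoly"
  let ?I = "ideal_of (extend ` I) :: ('n, real) mpoly set"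
  have "F = extend f + const (- 1) * const fstar" by (simp add: F mpoly.\<kappa>_minus)
  moreover have "const fstar \<in> polys_deg_le (int d)"
    by (rule polys_deg_le_mono[OF const_in_polys_deg_le]) simp
  ultimately have degF: "deg F \<le> d"
    using degf by (auto simp: deg_le_iff intro!: polys_deg_le_add polys_deg_le_const_mult)
  have g0': "?g 0 = 1" by (simp add: g0)
  have degg': "2 * D + deg (?g i) \<le> d" if "i \<le> m" for i using degg[OF that] by simp
  have nonneg': "\<forall>\<phi>. real_point \<phi> \<and> (\<forall>j\<in>{1..s}. \<phi> (?h j) = 0) \<and> (\<forall>i\<le>m. \<phi> (?g i) \<ge> 0) \<longrightarrow> \<phi> F \<ge> 0"
  proof (intro allI impI, elim conjE)
    fix \<phi> assume \<phi>: "real_point \<phi>" "\<forall>j\<in>{1..s}. \<phi> (?h j) = 0" "\<forall>i\<le>m. \<phi> (?g i) \<ge> 0"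
    define \<xi> where "\<xi> = (\<chi> i. \<phi> (var i))"
    have ev: "\<phi> p = eval \<xi> (p)" for p
      unfolding \<xi>_def by (rule real_point_is_evaluation[OF \<phi>(1)])
    have "\<xi> \<in> feasible m g s h"
      using \<phi>(2,3) by (simp add: feasible_def ev[symmetric])
    from nonneg[OF this] show "\<phi> F \<ge> 0" by (simp add: ev[symmetric])
  qed
  obtain N :: "nat \<Rightarrow> nat" and \<omega> q p where cert:
    "F = (\<Sum>i\<le>m. (\<Sum>k<N i. const (\<omega> i k) * (q i k)\<^sup>2) * ?g i) + (\<Sum>j=1..s. p j * ?h j)"
    "\<forall>i\<le>m. \<forall>k<N i. \<omega> i k \<ge> 0 \<and> q i k \<in> polys_deg_le (int D)"
    "\<forall>j\<in>{1..s}. p j \<in> polys_deg_le (int d - int (deg (?h j)))"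
    using sos_certificate[of s ?h ?I B D ?g F d m u v, OF graded_basis_extend[OF graded]
        spanning_monomials_extend[OF span] B g0' degF degg' comax nonneg'] by blast
  then show ?thesis using False by auto
qed

lemma certificate_in_quadratic_module:
  fixes g h :: "nat \<Rightarrow> ('n::finite, real) mpoly"
  assumes "\<And>i k. i \<le> m \<Longrightarrow> k < (N i :: nat) \<Longrightarrow> \<omega> i k \<ge> 0 \<and> q i k \<in> polys_deg_le (int D)"
    and "\<And>j. j \<in> {1..s} \<Longrightarrow> p j \<in> polys_deg_le (int d - int (deg (h j)))"
    and g0: "g 0 = 1" and degg: "\<And>i. i \<le> m \<Longrightarrow> 2 * D + deg (g i) \<le> d"
  shows "(\<Sum>i\<le>m. (\<Sum>k<N i. const (\<omega> i k) * (q i k)\<^sup>2) * g i) + (\<Sum>j=1..s. p j * h j)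
    \<in> quadratic_module m g s h (int d)"
proof -
  define \<sigma> where "\<sigma> i = (\<Sum>k<N i. const (\<omega> i k) * (q i k)\<^sup>2)" for i
  have \<sigma>: "\<sigma> i \<in> sos (int d - int (deg (g i)))" if "i \<le> m" for i
    unfolding \<sigma>_def
  proof (rule weighted_sum_in_sos)
    show "q i k \<in> polys_deg_le ((int d - int (deg (g i))) div 2)" if "k < N i" for k
      by (rule polys_deg_le_mono[of _ "int D"]) (use assms(1)[OF \<open>i \<le> m\<close> that] degg[OF \<open>i \<le> m\<close>] in auto)
  qed (use assms(1)[OF that] in blast)
  have "deg (1 :: ('n, real) mpoly) = 0"
    using const_in_polys_deg_le[of "1::real"] by (auto simp: polys_deg_le_def)
  then have "\<sigma> 0 + (\<Sum>i=1..m. g i * \<sigma> i) + (\<Sum>j=1..s. h j * p j) \<in> quadratic_module m g s h (int d)"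
    using \<sigma>[of 0] \<sigma> assms(2) by (intro quadratic_moduleI) (auto simp: g0)
  moreover have "(\<Sum>i\<le>m. \<sigma> i * g i) = \<sigma> 0 + (\<Sum>i=1..m. g i * \<sigma> i)"
    by (simp add: atMost_atLeast0 sum.atLeast_Suc_atMost g0 mult.commute)
  ultimately show ?thesis by (simp add: \<sigma>_def mult.commute)
qed

text \<open>
  The index 0 of the maximum shows that the degree of \<open>B\<close> is finite.
\<close>

lemma degree_bound_from_order:
  fixes g :: "nat \<Rightarrow> ('n::finite, 'a::zero) mpoly" and f :: "('n, 'b::zero) mpoly" and B :: "'n monom set"
  assumes "Max (insert (enat (deg f)) ((\<lambda>i. 2 * deg_set B + enat (deg (g i))) ` {0..m})) \<le> enat d"
  obtains D where "\<And>b. b \<in> B \<Longrightarrow> monom_deg b \<le> D" "\<And>i. i \<le> m \<Longrightarrow> 2 * D + deg (g i) \<le> d" "deg f \<le> d"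
proof -
  have bound: "deg f \<le> d" "\<And>i. i \<le> m \<Longrightarrow> 2 * deg_set B + enat (deg (g i)) \<le> enat d"
    using assms by (subst (asm) Max_le_iff; force)+
  have "deg_set B \<noteq> \<infinity>"
  proof
    assume "deg_set B = \<infinity>"
    then show False using bound(2)[of 0] by (simp add: numeral_eq_enat)
  qed
  then obtain D where D: "deg_set B = enat D" by (cases "deg_set B") auto
  have "monom_deg b \<le> D" if "b \<in> B" for b
    using SUP_upper[OF that, of "\<lambda>b. enat (monom_deg b)"] by (simp add: deg_set_def[symmetric] D)
  moreover have "2 * D + deg (g i) \<le> d" if "i \<le> m" for i
    using bound(2)[OF that] by (simp add: D numeral_eq_enat)
  ultimately show ?thesis using bound(1) that by blast
qed

theorem corollary1p1:
  fixes g h :: "nat \<Rightarrow> ('n::finite, rat) mpoly"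
    and m s l :: nat
    and I :: "('n, rat) mpoly set"
    and B :: "'n monom set"
    and f :: "('n, rat) mpoly"
    and S :: "(real ^ 'n) set"
    and fstar :: real
    and F :: "('n, real) mpoly"
  assumes I: "I = ideal_of (h ` {1..s})"
    and graded: "graded_basis s h I"
    and zero_dim: "zero_dimensional I"
    and basis: "monomial_basis B I"
    and S: "S = feasible m g s h" "S \<noteq> {}"
    and fstar: "fstar = Min ((\<lambda>\<xi>. eval \<xi> (extend f)) ` S)"
    and F: "F = extend f - const fstar"
    and colon: "colon_ideal (ideal_of (extend ` I)) F + ideal_of {F} = ideal_of {1}"
    and l: "Max (insert (enat (deg f))
                  ((\<lambda>i. 2 * deg_set B + enat (deg ((g(0 := 1)) i))) ` {0..m})) \<le> enat (2 * l)"
  shows "sos_bound m g s h f l = ereal fstar \<and>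
    (\<exists>(N :: nat \<Rightarrow> nat) (\<omega> :: nat \<Rightarrow> nat \<Rightarrow> real)
       (q :: nat \<Rightarrow> nat \<Rightarrow> ('n, real) mpoly) (p :: nat \<Rightarrow> ('n, real) mpoly).
       F = (\<Sum>k<N 0. const (\<omega> 0 k) * (q 0 k)\<^sup>2)
           + (\<Sum>i=1..m. (\<Sum>k<N i. const (\<omega> i k) * (q i k)\<^sup>2) * extend (g i))
           + (\<Sum>j=1..s. p j * extend (h j)) \<and>
       (\<forall>i\<in>{0..m}. \<forall>k<N i. \<omega> i k \<ge> 0) \<and>
       (\<forall>k<N 0. deg ((q 0 k)\<^sup>2) \<le> 2 * l) \<and>
       (\<forall>i\<in>{1..m}. \<forall>k<N i. deg ((q i k)\<^sup>2 * extend (g i)) \<le> 2 * l) \<and>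
       (\<forall>j\<in>{1..s}. deg (p j * extend (h j)) \<le> 2 * l) \<and>
       (fstar \<in> \<rat> \<longrightarrow>
          (\<forall>i\<in>{0..m}. \<forall>k<N i. \<omega> i k \<in> \<rat> \<and> q i k \<in> range extend) \<and>
          (\<forall>j\<in>{1..s}. p j \<in> range extend)))"
proof -
  define g' where "g' = g(0 := 1)"
  have g': "g' 0 = 1" "\<And>i. i \<in> {1..m} \<Longrightarrow> g' i = g i" by (auto simp: g'_def)
  obtain D where D: "\<And>b. b \<in> B \<Longrightarrow> monom_deg b \<le> D" "\<And>i. i \<le> m \<Longrightarrow> 2 * D + deg (g' i) \<le> 2 * l"
    "deg f \<le> 2 * l"
    using degree_bound_from_order[OF l] unfolding g'_def by metis
  have finB: "finite B" by (rule finite_subset[OF _ finite_monom_deg_le[of D]]) (use D(1) in auto)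
  have span: "\<exists>r. Poly_Mapping.keys r \<subseteq> B \<and> p - r \<in> I" for p
    using basis by (auto simp: monomial_basis_def)

  have feas: "feasible m g' s h = S" using g'(2) by (auto simp: S(1) feasible_def)
  have finS: "finite S" using finite_feasible zero_dim by (simp add: S(1) I)
  have fstar_le: "fstar \<le> eval \<xi> (extend f)" if "\<xi> \<in> S" for \<xi>
    unfolding fstar using finS that by (intro Min_le) auto
  have evF: "eval \<xi> F = eval \<xi> (extend f) - fstar" for \<xi>
    by (simp add: F real_pointD(6)[OF real_point_eval] eval_const)
  have "fstar \<in> (\<lambda>\<xi>. eval \<xi> (extend f)) ` S"
    unfolding fstar using finS S(2) by (intro Min_in) auto
  then obtain \<xi>0 where \<xi>0: "\<xi>0 \<in> S" "eval \<xi>0 (extend f) = fstar" by auto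

  have "1 \<in> colon_ideal (ideal_of (extend ` I)) F + ideal_of {F}"
    unfolding colon by (rule generator_in_ideal) simp
  then obtain u w where uw: "F * u \<in> ideal_of (extend ` I)" "w \<in> ideal_of {F}" "1 = u + w"
    by (auto simp: set_plus_def colon_ideal_def)
  then obtain v where "w = v * F" using ideal_of_singleton by blast
  with uw have uv: "u + v * F = 1" by simp
  have nonneg: "eval \<xi> F \<ge> 0" if "\<xi> \<in> feasible m g' s h" for \<xi>
    using fstar_le that by (simp add: feas evF)
  obtain N :: "nat \<Rightarrow> nat" and \<omega> q p where cert:
    "F = (\<Sum>i\<le>m. (\<Sum>k<N i. const (\<omega> i k) * (q i k)\<^sup>2) * extend (g' i)) + (\<Sum>j=1..s. p j * extend (h j))"
    "\<forall>i\<le>m. \<forall>k<N i. \<omega> i k \<ge> 0 \<and> q i k \<in> polys_deg_le (int D)"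
    "\<forall>j\<in>{1..s}. p j \<in> polys_deg_le (int (2 * l) - int (deg (h j)))"
    "fstar \<in> \<rat> \<longrightarrow> (\<forall>i\<le>m. \<forall>k<N i. \<omega> i k \<in> \<rat> \<and> q i k \<in> range extend) \<and>
      (\<forall>j\<in>{1..s}. p j \<in> range extend)"
    using graded_certificate_extend[of s h I B D g' f "2 * l" m F fstar u v, OF graded span finB D(1)
        g'(1) D(3) D(2) F uv uw(1) nonneg] by blast

  have qm_eq: "quadratic_module m (\<lambda>i. extend (g' i)) s (\<lambda>j. extend (h j)) d
      = quadratic_module m (\<lambda>i. extend (g i)) s (\<lambda>j. extend (h j) :: ('n, real) mpoly) d" for d
    unfolding quadratic_module_def using g'(2) by simp
  have "F \<in> quadratic_module m (\<lambda>i. extend (g' i)) s (\<lambda>j. extend (h j)) (int (2 * l))"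
    unfolding cert(1) using cert(2,3) D(2) g'(1)
    by (intro certificate_in_quadratic_module[where D = D]) auto
  then have FQ: "extend f - const fstar
      \<in> quadratic_module m (\<lambda>i. extend (g i)) s (\<lambda>j. extend (h j)) (2 * int l)"
    unfolding qm_eq by (simp add: F)

  have "sos_bound m g s h f l = ereal fstar"
    unfolding sos_bound_def
  proof (rule antisym)
    show "(SUP \<mu>\<in>{\<mu>. extend f - const \<mu> \<in> quadratic_module m (\<lambda>i. extend (g i)) s (\<lambda>j. extend (h j))
        (2 * int l)}. ereal \<mu>) \<le> ereal fstar"
    proof (rule SUP_least)
      fix \<mu> assume "\<mu> \<in> {\<mu>. extend f - const \<mu> \<in> quadratic_module m (\<lambda>i. extend (g i)) s
        (\<lambda>j. extend (h j)) (2 * int l)}"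
      then have "eval \<xi>0 (extend f - const \<mu>) \<ge> 0"
        using \<xi>0(1) by (auto simp: S(1) feasible_def elim!: quadratic_module_nonneg)
      then show "ereal \<mu> \<le> ereal fstar"
        by (simp add: real_pointD(6)[OF real_point_eval] eval_const \<xi>0(2))
    qed
    show "ereal fstar \<le> (SUP \<mu>\<in>{\<mu>. extend f - const \<mu> \<in> quadratic_module m (\<lambda>i. extend (g i)) s
        (\<lambda>j. extend (h j)) (2 * int l)}. ereal \<mu>)"
      by (rule SUP_upper) (use FQ in simp)
  qed
  moreover
  have term_deg: "deg ((q i k)\<^sup>2 * extend (g' i)) \<le> 2 * l" if "i \<le> m" "k < N i" for i k
  proof -
    have "(q i k)\<^sup>2 * extend (g' i) \<in> polys_deg_le (2 * int D + int (deg (g' i)))"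
      using cert(2) that by (intro polys_deg_le_mult polys_deg_le_square) (auto simp: polys_deg_le_def)
    then show ?thesis
      unfolding deg_le_iff by (rule polys_deg_le_mono) (use D(2)[OF that(1)] in linarith)
  qed
  have "deg ((q 0 k)\<^sup>2) \<le> 2 * l" if "k < N 0" for k
    using term_deg[of 0 k] that by (simp add: g'(1))
  moreover have "deg ((q i k)\<^sup>2 * extend (g i)) \<le> 2 * l" if "i \<in> {1..m}" "k < N i" for i k
    using term_deg[of i k] that by (simp add: g'(2))
  moreover have "deg (p j * extend (h j)) \<le> 2 * l" if "j \<in> {1..s}" for j
  proof -
    have "p j * extend (h j) \<in> polys_deg_le (int (2 * l) - int (deg (h j)) + int (deg (h j)))"
      using cert(3) that by (intro polys_deg_le_mult) (auto simp: polys_deg_le_def)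
    then show ?thesis unfolding deg_le_iff by simp
  qed
  moreover have "F = (\<Sum>k<N 0. const (\<omega> 0 k) * (q 0 k)\<^sup>2)
      + (\<Sum>i=1..m. (\<Sum>k<N i. const (\<omega> i k) * (q i k)\<^sup>2) * extend (g i))
      + (\<Sum>j=1..s. p j * extend (h j))"
    unfolding cert(1) atMost_atLeast0 by (subst sum.atLeast_Suc_atMost) (simp_all add: g')
  ultimately show ?thesis
    using cert(2,4)
    by (intro conjI exI[of _ N] exI[of _ \<omega>] exI[of _ q] exI[of _ p]) auto
qed

end
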